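(* Let $\mathbf{k}$ be a commutative ring and let $H$ be a graded $\mathbf{k}$-bialgebra. Let $\alpha=(\alpha_1,\alpha_2,\ldots,\alpha_k)\in\mathbb{N}^k$ be a weak composition, and let $\sigma\in\mathfrak{S}_k$ be a permutation. Let $\beta=(\beta_1,\beta_2,\ldots,\beta_\ell)\in\mathbb{N}^\ell$ be a weak composition, and let $\tau\in\mathfrak{S}_\ell$ be a permutation. Then $$p_{\alpha,\sigma}\circ p_{\beta,\tau}=\sum_{\substack{\gamma_{i,j}\in\mathbb{N}\text{ for all }i\in[k]\text{ and }j\in[\ell];\\ \gamma_{i,1}+\gamma_{i,2}+\cdots+\gamma_{i,\ell}=\alpha_i\text{ for all }i\in[k];\\ \gamma_{1,j}+\gamma_{2,j}+\cdots+\gamma_{k,j}=\beta_j\text{ for all }j\in[\ell]}}p_{(\gamma_{1,1},\gamma_{1,2},\ldots,\gamma_{k,\ell}),\ \tau[\sigma]}.$$ Here $(\gamma_{1,1},\gamma_{1,2},\ldots,\gamma_{k,\ell})$ denotes the $k\ell$-tuple consisting of all $k\ell$ numbers $\gamma_{i,j}$ (for all $i\in[k]$ and $j\in[\ell]$) listed in the order of lexicographically increasing pairs $(i,j)$ (i.e., $\gamma_{i,j}$ comes before $\gamma_{u,v}$ if and only if either $i<u$ or ($i=u$ and $j<v$)).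
   Context: $\mathbb{N}=\{0,1,2,\ldots\}$; $[k]=\{1,2,\ldots,k\}$; $\mathfrak{S}_k$ is the group of permutations of $[k]$. All modules, algebras, bialgebras and tensor products are over the commutative ring $\mathbf{k}$; algebras are associative and unital. "Graded" means $\mathbb{N}$-graded; a graded bialgebra $H=\bigoplus_{n\in\mathbb{N}}H_n$ is a bialgebra whose multiplication, unit, comultiplication and counit are graded maps (no sign twists in tensor products; $H$ is not required to be connected). $p_n:H\to H$ is the canonical projection onto the $n$-th graded component $H_n$. The maps $m^{[k]}:H^{\otimes k}\to H$ and $\Delta^{[k]}:H\to H^{\otimes k}$ are the $k$-fold iterated multiplication and comultiplication ($m^{[k]}(a_1\otimes\cdots\otimes a_k)=a_1\cdots a_k$, $\Delta^{[k]}(x)=\sum_{(x)}x_{(1)}\otimes\cdots\otimes x_{(k)}$; $m^{[0]}$ is the unit map $u:\mathbf{k}\to H$, $\Delta^{[0]}$ is the counit $\epsilon$, and $m^{[1]}=\Delta^{[1]}=\mathrm{id}$). The group $\mathfrak{S}_k$ acts on $H^{\otimes k}$ from the left by $\sigma\cdot(h_1\otimes\cdots\otimes h_k)=h_{\sigma^{-1}(1)}\otimes\cdots\otimes h_{\sigma^{-1}(k)}$. A weak composition is a finite tuple of nonnegative integers. For a weak composition $\alpha=(\alpha_1,\ldots,\alpha_k)$, let $P_\alpha:=p_{\alpha_1}\otimes p_{\alpha_2}\otimes\cdots\otimes p_{\alpha_k}:H^{\otimes k}\to H^{\otimes k}$. For $\alpha\in\mathbb{N}^k$ and $\sigma\in\mathfrak{S}_k$,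 define $p_{\alpha,\sigma}:=m^{[k]}\circ P_\alpha\circ\sigma^{-1}\circ\Delta^{[k]}:H\to H$, where $\sigma^{-1}$ means the action of $\sigma^{-1}$ on $H^{\otimes k}$. For $\sigma\in\mathfrak{S}_k$ and $\tau\in\mathfrak{S}_\ell$, $\tau[\sigma]\in\mathfrak{S}_{k\ell}$ denotes the permutation of $[k\ell]$ that sends each $\ell(i-1)+j$ (with $i\in[k]$ and $j\in[\ell]$) to $k(\tau(j)-1)+\sigma(i)$. *)

theory Defs
  imports Complex_Main "HOL-Library.Poly_Mapping" "HOL-Library.FuncSet"
    "HOL-Combinatorics.Permutations"
begin

section \<open>Tensor powers of a module\<close>

text \<open>
  The classes \<^class>\<open>comm_ring\<close> and \<^class>\<open>comm_monoid_mult\<close> together describe commutative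
  unital rings, \<^class>\<open>ring\<close> and \<^class>\<open>monoid_mult\<close> together associative unital rings. Unlike
  \<^class>\<open>comm_ring_1\<close> and \<^class>\<open>ring_1\<close> (and hence the library locale \<^locale>\<open>module\<close>), they do
  not exclude the zero ring.
\<close>

locale unital_module =
  fixes scale :: "'k::{comm_ring,comm_monoid_mult} \<Rightarrow> 'v::ab_group_add \<Rightarrow> 'v"
  assumes scale_right_distrib: "scale a (x + y) = scale a x + scale a y"
    and scale_left_distrib: "scale (a + b) x = scale a x + scale b x"
    and scale_scale: "scale a (scale b x) = scale (a * b) x"
    and scale_one: "scale 1 x = x"

text \<open>
  The free module on lists consists of the finitely supported functions on lists. An element of the
  \<open>n\<close>-th tensor power is an equivalence class of such functions supported on lists of length \<open>n\<close>.
\<close>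

type_synonym ('k, 'h) tensor = "('h list \<Rightarrow>\<^sub>0 'k) set"

definition free_scale :: "'k::mult_zero \<Rightarrow> ('i \<Rightarrow>\<^sub>0 'k) \<Rightarrow> ('i \<Rightarrow>\<^sub>0 'k)" where
  "free_scale c f = Poly_Mapping.map ((*) c) f"

definition lin_ext ::
  "('k::zero \<Rightarrow> 'v \<Rightarrow> 'v) \<Rightarrow> ('i \<Rightarrow> 'v) \<Rightarrow> ('i \<Rightarrow>\<^sub>0 'k) \<Rightarrow> 'v::comm_monoid_add" where
  "lin_ext scale \<phi> f = (\<Sum>i\<in>Poly_Mapping.keys f. scale (Poly_Mapping.lookup f i) (\<phi> i))"

definition formal_tensors :: "nat \<Rightarrow> ('h list \<Rightarrow>\<^sub>0 'k::zero) set" where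
  "formal_tensors n = {f. Poly_Mapping.keys f \<subseteq> {xs. length xs = n}}"

text \<open>A fixed but arbitrary representative of an equivalence class.\<close>

definition trep :: "('k::zero, 'h) tensor \<Rightarrow> ('h list \<Rightarrow>\<^sub>0 'k)" where
  "trep X = (SOME f. f \<in> X)"

context
  fixes scale :: "'k::{comm_ring,comm_monoid_mult} \<Rightarrow> 'h::{ring,monoid_mult} \<Rightarrow> 'h"
begin

inductive_set multilinear_relations :: "nat \<Rightarrow> ('h list \<Rightarrow>\<^sub>0 'k) set" for n :: nat where
  zero: "0 \<in> multilinear_relations n"
| add: "f \<in> multilinear_relations n \<Longrightarrow> g \<in> multilinear_relations n \<Longrightarrow>
    f + g \<in> multilinear_relations n"
| scale: "f \<in> multilinear_relations n \<Longrightarrow> free_scale c f \<in> multilinear_relations n"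
| slot_add: "length xs + 1 + length ys = n \<Longrightarrow>
    Poly_Mapping.single (xs @ (a + b) # ys) 1 - Poly_Mapping.single (xs @ a # ys) 1
      - Poly_Mapping.single (xs @ b # ys) 1 \<in> multilinear_relations n"
| slot_scale: "length xs + 1 + length ys = n \<Longrightarrow>
    Poly_Mapping.single (xs @ scale c a # ys) 1 - free_scale c (Poly_Mapping.single (xs @ a # ys) 1)
      \<in> multilinear_relations n"

definition tensor_eq :: "nat \<Rightarrow> (('h list \<Rightarrow>\<^sub>0 'k) \<times> ('h list \<Rightarrow>\<^sub>0 'k)) set" where
  "tensor_eq n = {(f, g). f \<in> formal_tensors n \<and> g \<in> formal_tensors n \<and>
     f - g \<in> multilinear_relations n}"

definition tensor_power :: "nat \<Rightarrow> ('k, 'h) tensor set" where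
  "tensor_power n = formal_tensors n // tensor_eq n"

definition tclass :: "nat \<Rightarrow> ('h list \<Rightarrow>\<^sub>0 'k) \<Rightarrow> ('k, 'h) tensor" where
  "tclass n f = tensor_eq n `` {f}"

definition pure_tensor :: "'h list \<Rightarrow> ('k, 'h) tensor" where
  "pure_tensor xs = tclass (length xs) (Poly_Mapping.single xs 1)"

definition tensor_add :: "nat \<Rightarrow> ('k, 'h) tensor \<Rightarrow> ('k, 'h) tensor \<Rightarrow> ('k, 'h) tensor" where
  "tensor_add n X Y = tclass n (trep X + trep Y)"

definition tensor_scale :: "nat \<Rightarrow> 'k \<Rightarrow> ('k, 'h) tensor \<Rightarrow> ('k, 'h) tensor" where
  "tensor_scale n c X = tclass n (free_scale c (trep X))"

text \<open>
  If \<open>\<phi>\<close> is multilinear on lists of length \<open>m\<close> with values in the \<open>n\<close>-th tensor power (resp.\ in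
  \<open>H\<close>), then \<open>tensor_lift n \<phi>\<close> (resp.\ \<open>tensor_eval \<phi>\<close>) restricts to the linear map on the \<open>m\<close>-th
  tensor power that it induces; only such \<open>\<phi>\<close> are used below.
\<close>

definition tensor_lift :: "nat \<Rightarrow> ('h list \<Rightarrow> ('k, 'h) tensor) \<Rightarrow> ('k, 'h) tensor \<Rightarrow> ('k, 'h) tensor"
  where "tensor_lift n \<phi> X = tclass n (lin_ext free_scale (\<lambda>xs. trep (\<phi> xs)) (trep X))"

definition tensor_eval :: "('h list \<Rightarrow> 'h) \<Rightarrow> ('k, 'h) tensor \<Rightarrow> 'h" where
  "tensor_eval \<phi> X = lin_ext scale \<phi> (trep X)"

text \<open>The canonical bilinear map from the \<open>m\<close>-th and the \<open>n\<close>-th to the \<open>(m + n)\<close>-th tensor power.\<close>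

definition tensor_juxt :: "nat \<Rightarrow> nat \<Rightarrow> ('k, 'h) tensor \<Rightarrow> ('k, 'h) tensor \<Rightarrow> ('k, 'h) tensor" where
  "tensor_juxt m n X Y =
     tensor_lift (m + n) (\<lambda>xs. tensor_lift (m + n) (\<lambda>ys. pure_tensor (xs @ ys)) Y) X"

text \<open>The product of the algebra \<open>H \<otimes> \<dots> \<otimes> H\<close>, without sign twists.\<close>

definition tensor_mult :: "nat \<Rightarrow> ('k, 'h) tensor \<Rightarrow> ('k, 'h) tensor \<Rightarrow> ('k, 'h) tensor" where
  "tensor_mult n X Y =
     tensor_lift n (\<lambda>xs. tensor_lift n (\<lambda>ys. pure_tensor (map2 (*) xs ys)) Y) X"

definition tensor_grade :: "(nat \<Rightarrow> 'h set) \<Rightarrow> nat \<Rightarrow> nat \<Rightarrow> ('k, 'h) tensor set" where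
  "tensor_grade G k n = tclass k ` {f \<in> formal_tensors k.
     \<forall>xs\<in>Poly_Mapping.keys f. \<exists>ds. sum_list ds = n \<and> list_all2 (\<lambda>x d. x \<in> G d) xs ds}"

end


section \<open>Graded bialgebras\<close>

definition graded_components ::
  "(nat \<Rightarrow> 'h set) \<Rightarrow> 'h::comm_monoid_add \<Rightarrow> (nat \<Rightarrow> 'h) \<Rightarrow> bool" where
  "graded_components G x c \<longleftrightarrow>
     (\<forall>n. c n \<in> G n) \<and> finite {n. c n \<noteq> 0} \<and> x = (\<Sum>n | c n \<noteq> 0. c n)"

text \<open>
  Scalars are identified with the zeroth tensor power in the usual way, so that the counit takes
  values in \<open>'k\<close> and the counit axioms read as below.
\<close>

locale graded_bialgebra = unital_module scale
  for scale :: "'k::{comm_ring,comm_monoid_mult} \<Rightarrow> 'h::{ring,monoid_mult} \<Rightarrow> 'h" +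
  fixes comult :: "'h \<Rightarrow> ('k, 'h) tensor"
    and counit :: "'h \<Rightarrow> 'k"
    and G :: "nat \<Rightarrow> 'h set"
  assumes scale_mult_left: "scale c x * y = scale c (x * y)"
    and scale_mult_right: "x * scale c y = scale c (x * y)"
    and comult_in: "comult x \<in> tensor_power scale 2"
    and comult_add: "comult (x + y) = tensor_add scale 2 (comult x) (comult y)"
    and comult_scale: "comult (scale c x) = tensor_scale scale 2 c (comult x)"
    and counit_add: "counit (x + y) = counit x + counit y"
    and counit_scale: "counit (scale c x) = c * counit x"
    and coassoc:
      "tensor_lift scale 3
         (\<lambda>xs. tensor_juxt scale 2 1 (comult (xs ! 0)) (pure_tensor scale [xs ! 1])) (comult x) =
       tensor_lift scale 3
         (\<lambda>xs. tensor_juxt scale 1 2 (pure_tensor scale [xs ! 0]) (comult (xs ! 1))) (comult x)"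
    and counit_left: "tensor_eval scale (\<lambda>xs. scale (counit (xs ! 0)) (xs ! 1)) (comult x) = x"
    and counit_right: "tensor_eval scale (\<lambda>xs. scale (counit (xs ! 1)) (xs ! 0)) (comult x) = x"
    and comult_mult: "comult (x * y) = tensor_mult scale 2 (comult x) (comult y)"
    and comult_one: "comult 1 = pure_tensor scale [1, 1]"
    and counit_mult: "counit (x * y) = counit x * counit y"
    and counit_one: "counit 1 = 1"
    and grade_zero: "0 \<in> G n"
    and grade_add: "x \<in> G n \<Longrightarrow> y \<in> G n \<Longrightarrow> x + y \<in> G n"
    and grade_scale: "x \<in> G n \<Longrightarrow> scale c x \<in> G n"
    and direct_sum: "\<exists>!c. graded_components G x c"
    and grade_mult: "x \<in> G m \<Longrightarrow> y \<in> G n \<Longrightarrow> x * y \<in> G (m + n)"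
    and grade_one: "1 \<in> G 0"
    and grade_comult: "x \<in> G n \<Longrightarrow> comult x \<in> tensor_grade scale G 2 n"
    and grade_counit: "x \<in> G n \<Longrightarrow> n \<noteq> 0 \<Longrightarrow> counit x = 0"


section \<open>The operators on a graded bialgebra\<close>

definition proj :: "(nat \<Rightarrow> 'h set) \<Rightarrow> nat \<Rightarrow> 'h::comm_monoid_add \<Rightarrow> 'h" where
  "proj G n x = (THE c. graded_components G x c) n"

context
  fixes scale :: "'k::{comm_ring,comm_monoid_mult} \<Rightarrow> 'h::{ring,monoid_mult} \<Rightarrow> 'h"
begin

text \<open>\<open>prod_list [] = 1\<close>, so on the zeroth tensor power this is the unit map.\<close>

definition iter_mult :: "('k, 'h) tensor \<Rightarrow> 'h" where
  "iter_mult = tensor_eval scale prod_list"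

fun iter_comult :: "('h \<Rightarrow> ('k, 'h) tensor) \<Rightarrow> ('h \<Rightarrow> 'k) \<Rightarrow> nat \<Rightarrow> 'h \<Rightarrow> ('k, 'h) tensor" where
  "iter_comult comult counit 0 x = tensor_scale scale 0 (counit x) (pure_tensor scale [])"
| "iter_comult comult counit (Suc 0) x = pure_tensor scale [x]"
| "iter_comult comult counit (Suc (Suc n)) x =
     tensor_lift scale (Suc (Suc n))
       (\<lambda>xs. tensor_juxt scale 1 (Suc n) (pure_tensor scale [xs ! 0])
               (iter_comult comult counit (Suc n) (xs ! 1)))
       (comult x)"

text \<open>Permutations act on \<open>{1..k}\<close>, whereas list positions start at 0.\<close>

definition perm_action :: "nat \<Rightarrow> (nat \<Rightarrow> nat) \<Rightarrow> ('k, 'h) tensor \<Rightarrow> ('k, 'h) tensor" where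
  "perm_action k \<sigma> =
     tensor_lift scale k (\<lambda>xs. pure_tensor scale (map (\<lambda>i. xs ! (inv \<sigma> i - 1)) [1..<k + 1]))"

definition proj_tensor :: "(nat \<Rightarrow> 'h set) \<Rightarrow> nat list \<Rightarrow> ('k, 'h) tensor \<Rightarrow> ('k, 'h) tensor" where
  "proj_tensor G \<alpha> = tensor_lift scale (length \<alpha>) (\<lambda>xs. pure_tensor scale (map2 (proj G) \<alpha> xs))"

definition p_op ::
  "('h \<Rightarrow> ('k, 'h) tensor) \<Rightarrow> ('h \<Rightarrow> 'k) \<Rightarrow> (nat \<Rightarrow> 'h set) \<Rightarrow> nat list \<Rightarrow> (nat \<Rightarrow> nat) \<Rightarrow> 'h \<Rightarrow> 'h"
  where
  "p_op comult counit G \<alpha> \<sigma> =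
     iter_mult \<circ> proj_tensor G \<alpha> \<circ> perm_action (length \<alpha>) (inv \<sigma>) \<circ>
       iter_comult comult counit (length \<alpha>)"

end


section \<open>Index combinatorics\<close>

text \<open>\<open>perm_subst k \<sigma> l \<tau>\<close> is \<open>\<tau>[\<sigma>]\<close>; the two lemmas below describe it.\<close>

definition perm_subst :: "nat \<Rightarrow> (nat \<Rightarrow> nat) \<Rightarrow> nat \<Rightarrow> (nat \<Rightarrow> nat) \<Rightarrow> nat \<Rightarrow> nat" where
  "perm_subst k \<sigma> l \<tau> m =
     (if m \<in> {1..k * l}
      then k * (\<tau> ((m - 1) mod l + 1) - 1) + \<sigma> ((m - 1) div l + 1) else m)"

lemma perm_subst_apply:
  assumes "i \<in> {1..k}" "j \<in> {1..l}"
  shows "perm_subst k \<sigma> l \<tau> (l * (i - 1) + j) = k * (\<tau> j - 1) + \<sigma> i"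
proof -
  obtain a b where ab: "i = Suc a" "j = Suc b" "a < k" "b < l"
    using assms by (cases i; cases j) auto
  have "l * a + b < k * l"
    using ab mult_le_mono1[of "Suc a" k l] by (simp add: algebra_simps)
  then show ?thesis
    using ab by (simp add: perm_subst_def)
qed

lemma perm_subst_permutes:
  assumes \<sigma>: "\<sigma> permutes {1..k}" and \<tau>: "\<tau> permutes {1..l}"
  shows "perm_subst k \<sigma> l \<tau> permutes {1..k * l}"
proof (rule bij_imp_permutes)
  let ?p = "perm_subst k \<sigma> l \<tau>"
  have img: "y \<in> ?p ` {1..k * l}" if y: "y \<in> {1..k * l}" for y
  proof -
    have pos: "k > 0" "l > 0" using y by (auto intro: Nat.gr0I)
    define u where "u = (y - 1) div k + 1"
    define v where "v = (y - 1) mod k + 1"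
    have "(y - 1) div k < l" using y pos by (intro less_mult_imp_div_less) (auto simp: mult.commute)
    then have u: "u \<in> {1..l}" by (simp add: u_def)
    have v: "v \<in> {1..k}" using pos by (simp add: v_def Suc_leI)
    have yuv: "y = k * (u - 1) + v"
      using y mult_div_mod_eq[of k "y - 1"] by (simp add: u_def v_def)
    obtain j where j: "j \<in> {1..l}" "\<tau> j = u" using u permutes_image[OF \<tau>] by (metis imageE)
    obtain i where i: "i \<in> {1..k}" "\<sigma> i = v" using v permutes_image[OF \<sigma>] by (metis imageE)
    have "?p (l * (i - 1) + j) = y" using perm_subst_apply[OF i(1) j(1)] i j yuv by simp
    moreover have "l * (i - 1) + j \<in> {1..k * l}"
    proof -
      have "l * (i - 1) + j \<le> l * (i - 1) + l" using j by simp
      also have "\<dots> = l * i" using i by (cases i) auto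
      also have "\<dots> \<le> k * l" using i by (simp add: mult.commute)
      finally show ?thesis using j by simp
    qed
    ultimately show ?thesis by force
  qed
  then have "{1..k * l} \<subseteq> ?p ` {1..k * l}" by blast
  then have "?p ` {1..k * l} = {1..k * l}"
    by (metis card_image_le card_subset_eq finite_atLeastAtMost finite_imageI card_mono le_antisym)
  then show "bij_betw ?p {1..k * l} {1..k * l}"
    by (simp add: bij_betw_def eq_card_imp_inj_on)
qed (auto simp: perm_subst_def)

text \<open>
  Functions on \<open>{1..k} \<times> {1..l}\<close> are taken to be \<^const>\<open>undefined\<close> outside, so that each
  matrix is counted once.
\<close>

definition contingency_tables :: "nat list \<Rightarrow> nat list \<Rightarrow> (nat \<times> nat \<Rightarrow> nat) set" where
  "contingency_tables \<alpha> \<beta> =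
     {\<gamma> \<in> {1..length \<alpha>} \<times> {1..length \<beta>} \<rightarrow>\<^sub>E UNIV.
        (\<forall>i\<in>{1..length \<alpha>}. (\<Sum>j=1..length \<beta>. \<gamma> (i, j)) = \<alpha> ! (i - 1)) \<and>
        (\<forall>j\<in>{1..length \<beta>}. (\<Sum>i=1..length \<alpha>. \<gamma> (i, j)) = \<beta> ! (j - 1))}"

lemma finite_contingency_tables: "finite (contingency_tables \<alpha> \<beta>)"
proof (rule finite_subset)
  let ?S = "{1..length \<alpha>} \<times> {1..length \<beta>}"
  show "contingency_tables \<alpha> \<beta> \<subseteq> ?S \<rightarrow>\<^sub>E {..sum_list \<alpha>}"
  proof
    fix \<gamma> assume g: "\<gamma> \<in> contingency_tables \<alpha> \<beta>"
    have "\<gamma> (i, j) \<le> sum_list \<alpha>" if i: "i \<in> {1..length \<alpha>}" and j: "j \<in> {1..length \<beta>}" for i j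
    proof -
      have "\<gamma> (i, j) \<le> (\<Sum>j=1..length \<beta>. \<gamma> (i, j))" using j by (intro member_le_sum) auto
      also have "\<dots> = \<alpha> ! (i - 1)" using g i by (auto simp: contingency_tables_def)
      also have "\<dots> \<le> sum_list \<alpha>" using i by (intro elem_le_sum_list) auto
      finally show ?thesis .
    qed
    then show "\<gamma> \<in> ?S \<rightarrow>\<^sub>E {..sum_list \<alpha>}"
      using g by (auto simp: contingency_tables_def PiE_iff)
  qed
qed (auto intro: finite_PiE)

definition row_reading :: "nat \<Rightarrow> nat \<Rightarrow> (nat \<times> nat \<Rightarrow> nat) \<Rightarrow> nat list" where
  "row_reading k l \<gamma> = concat (map (\<lambda>i. map (\<lambda>j. \<gamma> (i, j)) [1..<l + 1]) [1..<k + 1])"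

end

theory Submission
  imports Defs
begin

text \<open>
  Both sides take values in \<open>H\<close>, so tensors are only ever tested against \<open>H\<close>-valued multilinear
  functions \<open>\<phi>\<close>. In Sweedler notation, \<open>p_op \<alpha> \<sigma> x\<close> is the product over \<open>i\<close> of the
  \<open>\<alpha>\<^sub>i\<close>-components of \<open>x\<close> in slot \<open>\<sigma> i\<close>. Apply \<open>\<Delta>\<close> \<open>k\<close>-fold to the product
  \<open>p_op \<beta> \<tau> x\<close>: it is multiplicative, so this yields a \<open>k\<close>-fold comultiplication of each factor; it is
  graded, so the \<open>\<beta>\<^sub>j\<close>-component of the \<open>j\<close>-th factor splits into the components of all weak
  compositions of \<open>\<beta>\<^sub>j\<close> of length \<open>k\<close>, which are the columns of the matrix \<open>\<gamma>\<close>; and it is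
  coassociative, so the iterated comultiplications combine to a single \<open>k * l\<close>-fold one.
  Projecting the \<open>i\<close>-th product to degree \<open>\<alpha>\<^sub>i\<close> leaves the matrices with row sums \<open>\<alpha>\<close>.
\<close>


section \<open>Formal tensors\<close>

lemma lookup_free_scale: "Poly_Mapping.lookup (free_scale c f) i = c * Poly_Mapping.lookup f i"
  by (simp add: free_scale_def Poly_Mapping.map.rep_eq when_def)

lemma keys_free_scale: "Poly_Mapping.keys (free_scale c f) \<subseteq> Poly_Mapping.keys f"
  by (auto simp: in_keys_iff lookup_free_scale)

lemma formal_tensors_zero: "0 \<in> formal_tensors n"
  by (simp add: formal_tensors_def)

lemma formal_tensors_add:
  fixes f g :: "'h list \<Rightarrow>\<^sub>0 'k::monoid_add"
  shows "f \<in> formal_tensors n \<Longrightarrow> g \<in> formal_tensors n \<Longrightarrow> f + g \<in> formal_tensors n"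
  unfolding formal_tensors_def using Poly_Mapping.keys_add[of f g] by blast

lemma formal_tensors_scale:
  "f \<in> formal_tensors n \<Longrightarrow> free_scale c f \<in> formal_tensors n"
  unfolding formal_tensors_def using keys_free_scale[of c f] by blast

lemma formal_tensors_single: "length xs = n \<Longrightarrow> Poly_Mapping.single xs c \<in> formal_tensors n"
  by (simp add: formal_tensors_def)

lemma formal_tensors_lin_ext:
  fixes \<phi> :: "'i \<Rightarrow> 'h list \<Rightarrow>\<^sub>0 'k::{comm_ring,comm_monoid_mult}"
  assumes "\<And>i. i \<in> Poly_Mapping.keys f \<Longrightarrow> \<phi> i \<in> formal_tensors n"
  shows "lin_ext free_scale \<phi> f \<in> formal_tensors n"
proof -
  have "(\<Sum>i\<in>S. free_scale (Poly_Mapping.lookup f i) (\<phi> i)) \<in> formal_tensors n"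
    if "finite S" "S \<subseteq> Poly_Mapping.keys f" for S
    using that assms
    by (induction S rule: finite_induct)
      (auto intro: formal_tensors_add formal_tensors_scale formal_tensors_zero)
  then show ?thesis
    by (simp add: lin_ext_def)
qed

text \<open>\<open>f\<close> lies in its own class because \<open>0\<close> is a relation, so the
  choice in \<open>trep\<close> is made from a nonempty set. What controls this arbitrary choice is
  that it differs from \<open>f\<close> by a relation.\<close>

lemma trep_tclass:
  assumes "f \<in> formal_tensors n"
  shows "trep (tclass scale n f) \<in> formal_tensors n"
    and "f - trep (tclass scale n f) \<in> multilinear_relations scale n"
proof -
  have "f \<in> tclass scale n f"
    using assms by (simp add: tclass_def tensor_eq_def multilinear_relations.zero)
  then have "trep (tclass scale n f) \<in> tclass scale n f"
    unfolding trep_def by (rule someI)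
  then show "trep (tclass scale n f) \<in> formal_tensors n"
    and "f - trep (tclass scale n f) \<in> multilinear_relations scale n"
    by (auto simp: tclass_def tensor_eq_def)
qed

lemma tclass_in: "f \<in> formal_tensors n \<Longrightarrow> tclass scale n f \<in> tensor_power scale n"
  unfolding tclass_def tensor_power_def by (rule quotientI)

lemma tensor_powerE:
  assumes "X \<in> tensor_power scale n"
  obtains f where "f \<in> formal_tensors n" "X = tclass scale n f"
  using assms unfolding tclass_def tensor_power_def by (auto elim: quotientE)

lemma trep_formal: "X \<in> tensor_power scale n \<Longrightarrow> trep X \<in> formal_tensors n"
  by (metis tensor_powerE trep_tclass(1))

lemma length_trep_keys:
  "X \<in> tensor_power scale n \<Longrightarrow> xs \<in> Poly_Mapping.keys (trep X) \<Longrightarrow> length xs = n"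
  using trep_formal[of X scale n] by (auto simp: formal_tensors_def)

lemma pure_tensor_in: "length xs = n \<Longrightarrow> pure_tensor scale xs \<in> tensor_power scale n"
  by (auto simp: pure_tensor_def intro: tclass_in formal_tensors_single)

lemma tensor_scale_in:
  "X \<in> tensor_power scale n \<Longrightarrow> tensor_scale scale n c X \<in> tensor_power scale n"
  by (auto simp: tensor_scale_def intro!: tclass_in formal_tensors_scale trep_formal)

lemma lift_formal:
  fixes scale :: "'k::{comm_ring,comm_monoid_mult} \<Rightarrow> 'h::{ring,monoid_mult} \<Rightarrow> 'h"
  assumes "X \<in> tensor_power scale m" "\<And>xs. length xs = m \<Longrightarrow> \<psi> xs \<in> tensor_power scale n"
  shows "lin_ext free_scale (\<lambda>xs. trep (\<psi> xs)) (trep X) \<in> formal_tensors n"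
  using assms by (intro formal_tensors_lin_ext trep_formal[of _ scale]) (auto dest: length_trep_keys)

lemma tensor_lift_in:
  assumes "X \<in> tensor_power scale m" "\<And>xs. length xs = m \<Longrightarrow> \<psi> xs \<in> tensor_power scale n"
  shows "tensor_lift scale n \<psi> X \<in> tensor_power scale n"
  unfolding tensor_lift_def by (intro tclass_in lift_formal[OF assms])

lemma tensor_juxt_in:
  assumes "X \<in> tensor_power scale m" "Y \<in> tensor_power scale n" "m + n = r"
  shows "tensor_juxt scale m n X Y \<in> tensor_power scale r"
  unfolding tensor_juxt_def assms(3)
  by (intro tensor_lift_in[OF assms(1)] tensor_lift_in[OF assms(2)] pure_tensor_in)
    (simp add: assms(3))


section \<open>Evaluating tensors at multilinear functions\<close>

context unital_module
begin

section \<open>Linear extension from a basis of a free module\<close>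

lemma scale_zero_left: "scale 0 x = 0"
  using scale_left_distrib[of 0 0 x] by simp

lemma scale_zero_right: "scale c 0 = 0"
  using scale_right_distrib[of c 0 0] by simp

lemma scale_sum: "scale c (sum f S) = (\<Sum>i\<in>S. scale c (f i))"
  by (induction S rule: infinite_finite_induct) (simp_all add: scale_zero_right scale_right_distrib)

lemma lin_ext_superset:
  assumes "finite S" "Poly_Mapping.keys f \<subseteq> S"
  shows "lin_ext scale \<phi> f = (\<Sum>i\<in>S. scale (Poly_Mapping.lookup f i) (\<phi> i))"
  unfolding lin_ext_def
  by (intro sum.mono_neutral_left assms ballI) (simp add: in_keys_iff scale_zero_left)

lemma lin_ext_zero: "lin_ext scale \<phi> 0 = 0"
  by (simp add: lin_ext_def)

lemma lin_ext_add: "lin_ext scale \<phi> (f + g) = lin_ext scale \<phi> f + lin_ext scale \<phi> g"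
proof -
  let ?S = "Poly_Mapping.keys f \<union> Poly_Mapping.keys g"
  have "Poly_Mapping.keys (f + g) \<subseteq> ?S" by (rule Poly_Mapping.keys_add)
  then show ?thesis
    by (simp add: lin_ext_superset[of ?S] lookup_add scale_left_distrib sum.distrib)
qed

lemma lin_ext_scale: "lin_ext scale \<phi> (free_scale c f) = scale c (lin_ext scale \<phi> f)"
  using keys_free_scale[of c f]
  by (simp add: lin_ext_superset[of "Poly_Mapping.keys f"] lookup_free_scale scale_sum scale_scale)

lemma lin_ext_diff: "lin_ext scale \<phi> (f - g) = lin_ext scale \<phi> f - lin_ext scale \<phi> g"
  using lin_ext_add[of \<phi> "f - g" g] by simp

lemma lin_ext_single: "lin_ext scale \<phi> (Poly_Mapping.single i c) = scale c (\<phi> i)"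
  by (simp add: lin_ext_superset[of "{i}"])

lemma lin_ext_sum: "lin_ext scale \<phi> (sum f S) = (\<Sum>i\<in>S. lin_ext scale \<phi> (f i))"
  by (induction S rule: infinite_finite_induct) (simp_all add: lin_ext_zero lin_ext_add)

lemma lin_ext_lin_ext:
  "lin_ext scale \<psi> (lin_ext free_scale \<phi> f) = lin_ext scale (\<lambda>i. lin_ext scale \<psi> (\<phi> i)) f"
  by (simp add: lin_ext_def[of free_scale] lin_ext_sum lin_ext_scale lin_ext_def[of scale _ f])

text \<open>Fubini for two finite sums. Exchanging the order also exchanges the two coefficients,
  which is where commutativity of the scalars enters.\<close>

lemma lin_ext_swap:
  "lin_ext scale (\<lambda>i. lin_ext scale (\<lambda>j. \<Phi> i j) g) f = lin_ext scale (\<lambda>j. lin_ext scale (\<lambda>i. \<Phi> i j) f) g"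
  unfolding lin_ext_def scale_sum scale_scale
  by (subst sum.swap) (simp add: mult.commute)

section \<open>Linear and multilinear maps\<close>

definition lin :: "('v \<Rightarrow> 'v) \<Rightarrow> bool" where
  "lin f \<longleftrightarrow> (\<forall>x y. f (x + y) = f x + f y) \<and> (\<forall>c x. f (scale c x) = scale c (f x))"

lemma lin_add: "lin f \<Longrightarrow> f (x + y) = f x + f y"
  and lin_scale: "lin f \<Longrightarrow> f (scale c x) = scale c (f x)"
  by (simp_all add: lin_def)

lemma lin_zero: "lin f \<Longrightarrow> f 0 = 0"
  using lin_add[of f 0 0] by simp

lemma lin_sum: "lin f \<Longrightarrow> f (sum g S) = (\<Sum>i\<in>S. f (g i))"
  by (induction S rule: infinite_finite_induct) (simp_all add: lin_zero lin_add)

lemma lin_lin_ext: "lin f \<Longrightarrow> f (lin_ext scale \<phi> g) = lin_ext scale (\<lambda>i. f (\<phi> i)) g"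
  by (simp add: lin_ext_def lin_sum lin_scale)

lemma lin_compose: "lin f \<Longrightarrow> lin g \<Longrightarrow> lin (\<lambda>x. f (g x))"
  by (simp add: lin_def)

lemma lin_const_zero: "lin (\<lambda>x. 0)"
  by (simp add: lin_def scale_zero_right)

lemma lin_plus: "lin f \<Longrightarrow> lin g \<Longrightarrow> lin (\<lambda>x. f x + g x)"
  by (simp add: lin_def scale_right_distrib ac_simps)

lemma lin_sumI: "(\<And>i. i \<in> S \<Longrightarrow> lin (f i)) \<Longrightarrow> lin (\<lambda>x. \<Sum>i\<in>S. f i x)"
  by (induction S rule: infinite_finite_induct) (auto intro: lin_const_zero lin_plus)

lemma lin_smult: "lin f \<Longrightarrow> lin (\<lambda>x. scale c (f x))"
  by (simp add: lin_def scale_right_distrib scale_scale mult.commute)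

lemma lin_lin_extI:
  assumes "\<And>i. i \<in> Poly_Mapping.keys g \<Longrightarrow> lin (\<lambda>x. \<Phi> x i)"
  shows "lin (\<lambda>x. lin_ext scale (\<Phi> x) g)"
  unfolding lin_ext_def by (intro lin_sumI lin_smult assms)

text \<open>The slot is overwritten by list update, so that no list has to be split. Lists of other
  lengths are unconstrained, and for \<open>n = 0\<close> every function qualifies.\<close>

definition multilin :: "nat \<Rightarrow> ('v list \<Rightarrow> 'v) \<Rightarrow> bool" where
  "multilin n \<phi> \<longleftrightarrow> (\<forall>xs i. length xs = n \<longrightarrow> i < n \<longrightarrow> lin (\<lambda>a. \<phi> (xs[i := a])))"

lemma multilinI:
  "(\<And>xs i. length xs = n \<Longrightarrow> i < n \<Longrightarrow> lin (\<lambda>a. \<phi> (xs[i := a]))) \<Longrightarrow> multilin n \<phi>"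
  by (simp add: multilin_def)

lemma multilinD: "multilin n \<phi> \<Longrightarrow> length xs = n \<Longrightarrow> i < n \<Longrightarrow> lin (\<lambda>a. \<phi> (xs[i := a]))"
  by (simp add: multilin_def)

lemma multilin_cong:
  assumes "multilin n \<psi>" "\<And>xs. length xs = n \<Longrightarrow> \<phi> xs = \<psi> xs"
  shows "multilin n \<phi>"
  using assms by (simp add: multilin_def)

text \<open>Splits the list at the slot instead, which is the shape of the generators
  \<open>slot_add\<close> and \<open>slot_scale\<close>.\<close>

lemma multilin_slot:
  assumes "multilin n \<phi>" "length xs + 1 + length ys = n"
  shows "lin (\<lambda>a. \<phi> (xs @ a # ys))"
  \<comment> \<open>The placeholder \<open>undefined\<close> is overwritten by the update at
    position \<open>length xs\<close>.\<close>
  using multilinD[OF assms(1), of "xs @ undefined # ys" "length xs"] assms(2) by simp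

lemma
  assumes "multilin (Suc n) \<phi>"
  shows multilin_hd: "length xs = n \<Longrightarrow> lin (\<lambda>a. \<phi> (a # xs))"
    and multilin_tl: "multilin n (\<lambda>xs. \<phi> (a # xs))"
proof -
  show "length xs = n \<Longrightarrow> lin (\<lambda>a. \<phi> (a # xs))"
    using multilin_slot[OF assms, of "[]" xs] by simp
  show "multilin n (\<lambda>xs. \<phi> (a # xs))"
  proof (rule multilinI)
    fix xs :: "'v list" and i assume "length xs = n" "i < n"
    then show "lin (\<lambda>b. \<phi> (a # xs[i := b]))"
      using multilinD[OF assms, of "a # xs" "Suc i"] by simp
  qed
qed

lemma
  assumes "multilin (m + n) \<phi>"
  shows multilin_append_left: "length ys = n \<Longrightarrow> multilin m (\<lambda>xs. \<phi> (xs @ ys))"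
    and multilin_append_right: "length xs = m \<Longrightarrow> multilin n (\<lambda>ys. \<phi> (xs @ ys))"
proof -
  show "multilin m (\<lambda>xs. \<phi> (xs @ ys))" if "length ys = n"
  proof (rule multilinI)
    fix xs :: "'v list" and i assume "length xs = m" "i < m"
    then show "lin (\<lambda>b. \<phi> (xs[i := b] @ ys))"
      using multilinD[OF assms, of "xs @ ys" i] that by (simp add: list_update_append1)
  qed
  show "multilin n (\<lambda>ys. \<phi> (xs @ ys))" if "length xs = m"
  proof (rule multilinI)
    fix ys :: "'v list" and i assume "length ys = n" "i < n"
    then show "lin (\<lambda>b. \<phi> (xs @ ys[i := b]))"
      using multilinD[OF assms, of "xs @ ys" "length xs + i"] that by (simp add: list_update_append)
  qed
qed

lemma multilin_map2:
  assumes "multilin n \<phi>" "length cs = n" "\<And>c. c \<in> set cs \<Longrightarrow> lin (f c)"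
  shows "multilin n (\<lambda>xs. \<phi> (map2 f cs xs))"
proof (rule multilinI)
  fix xs :: "'v list" and i assume xs: "length xs = n" "i < n"
  have "map2 f cs (xs[i := a]) = (map2 f cs xs)[i := f (cs ! i) a]" for a
    by (rule nth_equalityI) (use xs assms in \<open>auto simp: nth_list_update\<close>)
  moreover have "lin (\<lambda>a. \<phi> ((map2 f cs xs)[i := f (cs ! i) a]))"
    using xs assms
    by (intro lin_compose[OF multilinD[OF assms(1), of "map2 f cs xs" i], where g = "f (cs ! i)"]) auto
  ultimately show "lin (\<lambda>a. \<phi> (map2 f cs (xs[i := a])))" by simp
qed

lemma multilin_permute:
  assumes "multilin n \<phi>" "\<pi> permutes {..<n}"
  shows "multilin n (\<lambda>xs. \<phi> (permute_list \<pi> xs))"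
proof (rule multilinI)
  fix xs :: "'v list" and i assume xs: "length xs = n" "i < n"
  \<comment> \<open>Entry \<open>r\<close> of the permuted list is \<open>xs ! \<pi> r\<close>, so
    slot \<open>i\<close> of \<open>xs\<close> turns up at position
    \<open>inv \<pi> i\<close>.\<close>
  have "inv \<pi> i < n"
    using xs permutes_in_image[OF permutes_inv[OF assms(2)], of i] by simp
  moreover have "permute_list \<pi> (xs[i := a]) = (permute_list \<pi> xs)[inv \<pi> i := a]" for a
  proof (rule nth_equalityI)
    fix r assume "r < length (permute_list \<pi> (xs[i := a]))"
    then show "permute_list \<pi> (xs[i := a]) ! r = (permute_list \<pi> xs)[inv \<pi> i := a] ! r"
      using xs assms(2) permutes_in_image[OF assms(2), of r] permutes_inv_eq[OF assms(2), of i r]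
      by (auto simp: permute_list_nth nth_list_update)
  qed simp
  ultimately show "lin (\<lambda>a. \<phi> (permute_list \<pi> (xs[i := a])))"
    using multilinD[OF assms(1), of "permute_list \<pi> xs" "inv \<pi> i"] xs by simp
qed

end

section \<open>The universal property of tensor powers\<close>

context graded_bialgebra
begin

text \<open>A multilinear function kills the generators, as \<open>slot_add\<close> and
  \<open>slot_scale\<close> express additivity and homogeneity in one slot; sums and multiples
  follow by linearity.\<close>

lemma lin_ext_relation:
  assumes "f \<in> multilinear_relations scale n" "multilin n \<phi>"
  shows "lin_ext scale \<phi> f = 0"
  using assms(1)
proof induction
  case (slot_add xs ys a b)
  then show ?case
    using lin_add[OF multilin_slot[OF assms(2) slot_add], of a b]
    by (simp add: lin_ext_diff lin_ext_single scale_one)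
next
  case (slot_scale xs ys c a)
  then show ?case
    using lin_scale[OF multilin_slot[OF assms(2) slot_scale], of c a]
    by (simp add: lin_ext_diff lin_ext_single lin_ext_scale scale_one)
qed (simp_all add: lin_ext_zero lin_ext_add lin_ext_scale scale_zero_right)

abbreviation ev :: "('h list \<Rightarrow> 'h) \<Rightarrow> ('k, 'h) tensor \<Rightarrow> 'h" where
  "ev \<equiv> tensor_eval scale"

text \<open>\<open>tensor_eval\<close> looks at the representative picked by \<open>trep\<close>; by
  \<open>lin_ext_relation\<close> the representative \<open>f\<close> gives the same value.\<close>

lemma ev_tclass:
  assumes "multilin n \<phi>" "f \<in> formal_tensors n"
  shows "ev \<phi> (tclass scale n f) = lin_ext scale \<phi> f"
  using lin_ext_relation[OF trep_tclass(2)[OF assms(2)] assms(1)]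
  by (simp add: tensor_eval_def lin_ext_diff)

lemma ev_pure:
  assumes "multilin (length xs) \<phi>"
  shows "ev \<phi> (pure_tensor scale xs) = \<phi> xs"
  by (simp add: pure_tensor_def ev_tclass[OF assms] formal_tensors_single lin_ext_single scale_one)

lemma ev_add:
  assumes "multilin n \<phi>" "X \<in> tensor_power scale n" "Y \<in> tensor_power scale n"
  shows "ev \<phi> (tensor_add scale n X Y) = ev \<phi> X + ev \<phi> Y"
  unfolding tensor_add_def
    ev_tclass[OF assms(1) formal_tensors_add[OF trep_formal[OF assms(2)] trep_formal[OF assms(3)]]]
  by (simp add: lin_ext_add tensor_eval_def)

lemma ev_scale:
  assumes "multilin n \<phi>" "X \<in> tensor_power scale n"
  shows "ev \<phi> (tensor_scale scale n c X) = scale c (ev \<phi> X)"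
  unfolding tensor_scale_def ev_tclass[OF assms(1) formal_tensors_scale[OF trep_formal[OF assms(2)]]]
  by (simp add: lin_ext_scale tensor_eval_def)

text \<open>Turns a tensor-valued construction into nested evaluations with values in
  \<open>H\<close>.\<close>

lemma ev_lift:
  assumes "multilin n \<phi>" "X \<in> tensor_power scale m"
    and "\<And>xs. length xs = m \<Longrightarrow> \<psi> xs \<in> tensor_power scale n"
  shows "ev \<phi> (tensor_lift scale n \<psi> X) = ev (\<lambda>xs. ev \<phi> (\<psi> xs)) X"
proof -
  have "lin_ext free_scale (\<lambda>xs. trep (\<psi> xs)) (trep X) \<in> formal_tensors n"
    using assms(2,3) by (rule lift_formal)
  from ev_tclass[OF assms(1) this] show ?thesis
    by (simp add: tensor_lift_def lin_ext_lin_ext tensor_eval_def)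
qed

lemma ev_cong:
  assumes "X \<in> tensor_power scale n" "\<And>xs. length xs = n \<Longrightarrow> \<phi> xs = \<psi> xs"
  shows "ev \<phi> X = ev \<psi> X"
  unfolding tensor_eval_def lin_ext_def
  using assms by (intro sum.cong) (auto dest: length_trep_keys)

lemma ev_swap: "ev (\<lambda>xs. ev (\<lambda>ys. \<Phi> xs ys) Y) X = ev (\<lambda>ys. ev (\<lambda>xs. \<Phi> xs ys) X) Y"
  unfolding tensor_eval_def by (rule lin_ext_swap)

lemma ev_plus: "ev (\<lambda>xs. \<phi> xs + \<psi> xs) X = ev \<phi> X + ev \<psi> X"
  by (simp add: tensor_eval_def lin_ext_def scale_right_distrib sum.distrib)

lemma ev_zero: "ev (\<lambda>xs. 0) X = 0"
  by (simp add: tensor_eval_def lin_ext_def scale_zero_right)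

lemma ev_sum: "ev (\<lambda>xs. \<Sum>i\<in>S. \<phi> i xs) X = (\<Sum>i\<in>S. ev (\<phi> i) X)"
  by (induction S rule: infinite_finite_induct) (simp_all add: ev_zero ev_plus)

lemma lin_ev: "lin f \<Longrightarrow> f (ev \<phi> X) = ev (\<lambda>xs. f (\<phi> xs)) X"
  unfolding tensor_eval_def by (rule lin_lin_ext)

lemma lin_evI:
  assumes "X \<in> tensor_power scale n" "\<And>xs. length xs = n \<Longrightarrow> lin (\<lambda>x. \<Phi> x xs)"
  shows "lin (\<lambda>x. ev (\<Phi> x) X)"
  unfolding tensor_eval_def using assms by (intro lin_lin_extI) (auto dest: length_trep_keys)

lemma multilin_evI:
  assumes "X \<in> tensor_power scale n" "\<And>ys. length ys = n \<Longrightarrow> multilin m (\<lambda>xs. \<Phi> xs ys)"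
  shows "multilin m (\<lambda>xs. ev (\<Phi> xs) X)"
  by (intro multilinI lin_evI[OF assms(1)] multilinD[OF assms(2)])

text \<open>Juxtaposition is a lift inside a lift, so \<open>ev_lift\<close> is applied twice; the
  same scheme serves \<open>ev_mult\<close>.\<close>

lemma ev_juxt:
  assumes "multilin (m + n) \<phi>" "X \<in> tensor_power scale m" "Y \<in> tensor_power scale n"
  shows "ev \<phi> (tensor_juxt scale m n X Y) = ev (\<lambda>xs. ev (\<lambda>ys. \<phi> (xs @ ys)) Y) X"
proof -
  have "ev \<phi> (tensor_juxt scale m n X Y) =
      ev (\<lambda>xs. ev \<phi> (tensor_lift scale (m + n) (\<lambda>ys. pure_tensor scale (xs @ ys)) Y)) X"
    unfolding tensor_juxt_def
    by (intro ev_lift[OF assms(1,2)] tensor_lift_in[OF assms(3)] pure_tensor_in) simp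
  also have "\<dots> = ev (\<lambda>xs. ev (\<lambda>ys. \<phi> (xs @ ys)) Y) X"
  proof (rule ev_cong[OF assms(2)])
    fix xs :: "'h list" assume xs: "length xs = m"
    have "ev \<phi> (tensor_lift scale (m + n) (\<lambda>ys. pure_tensor scale (xs @ ys)) Y)
        = ev (\<lambda>ys. ev \<phi> (pure_tensor scale (xs @ ys))) Y"
      by (intro ev_lift[OF assms(1,3)] pure_tensor_in) (simp add: xs)
    also have "\<dots> = ev (\<lambda>ys. \<phi> (xs @ ys)) Y"
      using assms(1) xs by (intro ev_cong[OF assms(3)] ev_pure) simp
    finally show "ev \<phi> (tensor_lift scale (m + n) (\<lambda>ys. pure_tensor scale (xs @ ys)) Y)
        = ev (\<lambda>ys. \<phi> (xs @ ys)) Y" .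
  qed
  finally show ?thesis .
qed

lemma ev_mult:
  assumes "multilin n \<phi>" "X \<in> tensor_power scale n" "Y \<in> tensor_power scale n"
  shows "ev \<phi> (tensor_mult scale n X Y) = ev (\<lambda>xs. ev (\<lambda>ys. \<phi> (map2 (*) xs ys)) Y) X"
proof -
  have "ev \<phi> (tensor_mult scale n X Y) =
      ev (\<lambda>xs. ev \<phi> (tensor_lift scale n (\<lambda>ys. pure_tensor scale (map2 (*) xs ys)) Y)) X"
    unfolding tensor_mult_def
    by (intro ev_lift[OF assms(1,2)] tensor_lift_in[OF assms(3)] pure_tensor_in) simp
  also have "\<dots> = ev (\<lambda>xs. ev (\<lambda>ys. \<phi> (map2 (*) xs ys)) Y) X"
  proof (rule ev_cong[OF assms(2)])
    fix xs :: "'h list" assume xs: "length xs = n"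
    have "ev \<phi> (tensor_lift scale n (\<lambda>ys. pure_tensor scale (map2 (*) xs ys)) Y)
        = ev (\<lambda>ys. ev \<phi> (pure_tensor scale (map2 (*) xs ys))) Y"
      by (intro ev_lift[OF assms(1,3)] pure_tensor_in) (simp add: xs)
    also have "\<dots> = ev (\<lambda>ys. \<phi> (map2 (*) xs ys)) Y"
      using assms(1) xs by (intro ev_cong[OF assms(3)] ev_pure) simp
    finally show "ev \<phi> (tensor_lift scale n (\<lambda>ys. pure_tensor scale (map2 (*) xs ys)) Y)
        = ev (\<lambda>ys. \<phi> (map2 (*) xs ys)) Y" .
  qed
  finally show ?thesis .
qed

section \<open>Sweedler notation for the bialgebra axioms\<close>

definition bilin :: "('h \<Rightarrow> 'h \<Rightarrow> 'h) \<Rightarrow> bool" where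
  "bilin F \<longleftrightarrow> (\<forall>b. lin (\<lambda>a. F a b)) \<and> (\<forall>a. lin (F a))"

lemma bilinI: "(\<And>b. lin (\<lambda>a. F a b)) \<Longrightarrow> (\<And>a. lin (F a)) \<Longrightarrow> bilin F"
  by (simp add: bilin_def)

lemma bilinD: "bilin F \<Longrightarrow> lin (\<lambda>a. F a b)" "bilin F \<Longrightarrow> lin (\<lambda>b. F a b)"
  by (simp_all add: bilin_def)

lemma multilin_bilin: "bilin F \<Longrightarrow> multilin 2 (\<lambda>xs. F (xs ! 0) (xs ! 1))"
proof (rule multilinI)
  fix xs :: "'h list" and i :: nat assume "bilin F" "length xs = 2" "i < 2"
  moreover from \<open>i < 2\<close> have "i = 0 \<or> i = 1" by linarith
  ultimately show "lin (\<lambda>a. F (xs[i := a] ! 0) (xs[i := a] ! 1))"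
    by (auto simp: bilinD)
qed

text \<open>The Sweedler sum of \<open>F\<close> over the two tensor factors of
  \<open>comult x\<close>; for bilinear \<open>F\<close> it does not depend on the
  representative.\<close>

definition sweedler :: "('h \<Rightarrow> 'h \<Rightarrow> 'h) \<Rightarrow> 'h \<Rightarrow> 'h" where
  "sweedler F x = ev (\<lambda>xs. F (xs ! 0) (xs ! 1)) (comult x)"

lemma lin_sweedler:
  assumes "bilin F"
  shows "lin (sweedler F)"
  unfolding lin_def sweedler_def comult_add comult_scale
  by (simp add: ev_add[OF multilin_bilin[OF assms]] ev_scale[OF multilin_bilin[OF assms]] comult_in
      del: One_nat_def)

lemma sweedler_cong: "(\<And>a b. F a b = F' a b) \<Longrightarrow> sweedler F x = sweedler F' x"
  by (simp add: sweedler_def)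

lemma sweedler_sum: "sweedler (\<lambda>a b. \<Sum>i\<in>S. F i a b) x = (\<Sum>i\<in>S. sweedler (F i) x)"
  by (simp add: sweedler_def ev_sum)

lemma sweedler_ev: "sweedler (\<lambda>a b. ev (\<lambda>ys. \<Phi> a b ys) Y) x = ev (\<lambda>ys. sweedler (\<lambda>a b. \<Phi> a b ys) x) Y"
  unfolding sweedler_def by (rule ev_swap)

text \<open>The axiom \<open>coassoc\<close> evaluated at the trilinear function
  \<open>?\<phi>\<close> built from \<open>F\<close>: the two lifts into the third tensor power
  become the two iterated Sweedler sums.\<close>

lemma sweedler_coassoc:
  assumes "\<And>b c. lin (\<lambda>a. F a b c)" "\<And>a c. lin (\<lambda>b. F a b c)" "\<And>a b. lin (\<lambda>c. F a b c)"
  shows "sweedler (\<lambda>a b. sweedler (\<lambda>c d. F c d b) a) x = sweedler (\<lambda>a b. sweedler (\<lambda>c d. F a c d) b) x"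
proof -
  let ?\<phi> = "\<lambda>xs. F (xs ! 0) (xs ! 1) (xs ! 2)"
  have \<phi>: "multilin 3 ?\<phi>"
  proof (rule multilinI)
    fix xs :: "'h list" and i :: nat assume "length xs = 3" "i < 3"
    then consider "i = 0" | "i = 1" | "i = 2" by linarith
    then show "lin (\<lambda>a. ?\<phi> (xs[i := a]))"
      by cases (use assms \<open>length xs = 3\<close> in simp_all)
  qed
  \<comment> \<open>The arity is rewritten as the sum that \<open>ev_juxt\<close> and
    \<open>multilin_append_left\<close> expect.\<close>
  have "(1::nat) + 2 = 3" by simp
  with \<phi> have \<phi>': "multilin (1 + 2) ?\<phi>" by (simp only:)
  have p: "\<And>x. pure_tensor scale [x] \<in> tensor_power scale 1" by (rule pure_tensor_in) simp
  have single: "ev \<psi> (pure_tensor scale [b]) = \<psi> [b]" if "multilin 1 \<psi>" for \<psi> b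
    using that by (simp add: ev_pure)
  have "sweedler (\<lambda>a b. sweedler (\<lambda>c d. F c d b) a) x =
      ev ?\<phi> (tensor_lift scale 3
         (\<lambda>xs. tensor_juxt scale 2 1 (comult (xs ! 0)) (pure_tensor scale [xs ! 1])) (comult x))"
    (is "?l = ev _ ?L")
  proof -
    have "ev ?\<phi> ?L = ev (\<lambda>xs. ev ?\<phi> (tensor_juxt scale 2 1 (comult (xs ! 0)) (pure_tensor scale [xs ! 1]))) (comult x)"
      by (intro ev_lift[OF \<phi> comult_in] tensor_juxt_in[OF comult_in p]) simp
    also have "\<dots> = ?l"
      unfolding sweedler_def
    proof (rule ev_cong[OF comult_in])
      fix xs :: "'h list"
      have "ev ?\<phi> (tensor_juxt scale 2 1 (comult (xs ! 0)) (pure_tensor scale [xs ! 1]))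
        = ev (\<lambda>ys. ev (\<lambda>zs. ?\<phi> (ys @ zs)) (pure_tensor scale [xs ! 1])) (comult (xs ! 0))"
        using \<phi> by (intro ev_juxt comult_in p) simp
      also have "\<dots> = ev (\<lambda>ys. F (ys ! 0) (ys ! 1) (xs ! 1)) (comult (xs ! 0))"
      proof (rule ev_cong[OF comult_in])
        fix ys :: "'h list" assume ys: "length ys = 2"
        have "multilin 1 (\<lambda>zs. ?\<phi> (ys @ zs))"
          using \<phi> ys by (intro multilin_append_right[where m = 2]) simp_all
        from single[OF this] ys
        show "ev (\<lambda>zs. ?\<phi> (ys @ zs)) (pure_tensor scale [xs ! 1]) = F (ys ! 0) (ys ! 1) (xs ! 1)"
          by (simp add: nth_append)
      qed
      finally show "ev ?\<phi> (tensor_juxt scale 2 1 (comult (xs ! 0)) (pure_tensor scale [xs ! 1]))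
        = ev (\<lambda>ys. F (ys ! 0) (ys ! 1) (xs ! 1)) (comult (xs ! 0))" .
    qed
    finally show ?thesis ..
  qed
  moreover have "sweedler (\<lambda>a b. sweedler (\<lambda>c d. F a c d) b) x =
      ev ?\<phi> (tensor_lift scale 3
         (\<lambda>xs. tensor_juxt scale 1 2 (pure_tensor scale [xs ! 0]) (comult (xs ! 1))) (comult x))"
    (is "?r = ev _ ?R")
  proof -
    have "ev ?\<phi> ?R = ev (\<lambda>xs. ev ?\<phi> (tensor_juxt scale 1 2 (pure_tensor scale [xs ! 0]) (comult (xs ! 1)))) (comult x)"
      by (intro ev_lift[OF \<phi> comult_in] tensor_juxt_in[OF p comult_in]) simp
    also have "\<dots> = ?r"
      unfolding sweedler_def
    proof (rule ev_cong[OF comult_in])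
      fix xs :: "'h list"
      have "ev ?\<phi> (tensor_juxt scale 1 2 (pure_tensor scale [xs ! 0]) (comult (xs ! 1)))
        = ev (\<lambda>ys. ev (\<lambda>zs. ?\<phi> (ys @ zs)) (comult (xs ! 1))) (pure_tensor scale [xs ! 0])"
        by (intro ev_juxt[OF \<phi>'] comult_in p)
      also have "\<dots> = ev (\<lambda>zs. ?\<phi> ([xs ! 0] @ zs)) (comult (xs ! 1))"
        by (intro single multilin_evI[OF comult_in] multilin_append_left[OF \<phi>'])
      finally show "ev ?\<phi> (tensor_juxt scale 1 2 (pure_tensor scale [xs ! 0]) (comult (xs ! 1)))
        = ev (\<lambda>ys. F (xs ! 0) (ys ! 0) (ys ! 1)) (comult (xs ! 1))"
        by (simp add: numeral_2_eq_2)
    qed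
    finally show ?thesis ..
  qed
  ultimately show ?thesis by (simp only: coassoc)
qed

lemma sweedler_counit_left: "lin f \<Longrightarrow> sweedler (\<lambda>a b. scale (counit a) (f b)) x = f x"
  using lin_ev[of f "\<lambda>xs. scale (counit (xs ! 0)) (xs ! 1)" "comult x"]
  by (simp add: counit_left sweedler_def lin_scale del: One_nat_def)

lemma sweedler_counit_right: "lin f \<Longrightarrow> sweedler (\<lambda>a b. scale (counit b) (f a)) x = f x"
  using lin_ev[of f "\<lambda>xs. scale (counit (xs ! 1)) (xs ! 0)" "comult x"]
  by (simp add: counit_right sweedler_def lin_scale del: One_nat_def)

lemma sweedler_mult:
  assumes "bilin F"
  shows "sweedler F (x * y) = sweedler (\<lambda>a b. sweedler (\<lambda>c d. F (a * c) (b * d)) y) x"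
  unfolding sweedler_def comult_mult ev_mult[OF multilin_bilin[OF assms] comult_in comult_in]
  by (intro ev_cong[OF comult_in]) simp

lemma sweedler_one: "bilin F \<Longrightarrow> sweedler F 1 = F 1 1"
  unfolding sweedler_def comult_one
  by (subst ev_pure) (simp_all add: multilin_bilin numeral_2_eq_2[symmetric] del: One_nat_def)

section \<open>Iterated comultiplication and generalized coassociativity\<close>

abbreviation D :: "nat \<Rightarrow> 'h \<Rightarrow> ('k, 'h) tensor" where
  "D \<equiv> iter_comult scale comult counit"

lemma D_in: "D n x \<in> tensor_power scale n"
proof (induction n arbitrary: x rule: less_induct)
  case (less n)
  consider "n = 0" | "n = Suc 0" | m where "n = Suc (Suc m)" by (metis not0_implies_Suc)
  then show ?case
  proof cases
    case 3
    have "tensor_lift scale n (\<lambda>xs. tensor_juxt scale 1 (Suc m) (pure_tensor scale [xs ! 0])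
        (D (Suc m) (xs ! 1))) (comult x) \<in> tensor_power scale n"
      by (intro tensor_lift_in[OF comult_in] tensor_juxt_in[OF pure_tensor_in less.IH])
        (simp_all add: 3)
    then show ?thesis by (simp add: 3)
  qed (simp_all add: tensor_scale_in pure_tensor_in)
qed

lemma ev_D_zero: "ev \<phi> (D 0 x) = scale (counit x) (\<phi> [])"
proof -
  have \<phi>: "multilin 0 \<phi>" by (simp add: multilin_def)
  then show ?thesis by (simp add: ev_scale[OF \<phi>] ev_pure pure_tensor_in)
qed

text \<open>\<open>iter_comult\<close> peels off a factor only from two factors onward. At one
  factor the same formula is the right counit axiom, as \<open>D 0\<close> is the counit, so later
  inductions can start at \<open>0\<close>.\<close>

lemma ev_D_Suc:
  assumes "multilin (Suc n) \<phi>"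
  shows "ev \<phi> (D (Suc n) x) = sweedler (\<lambda>a b. ev (\<lambda>ys. \<phi> (a # ys)) (D n b)) x"
proof (cases n)
  case 0
  have "ev \<phi> (D (Suc n) x) = \<phi> [x]"
    using assms by (simp add: 0 ev_pure)
  also have "\<dots> = sweedler (\<lambda>a b. ev (\<lambda>ys. \<phi> (a # ys)) (D n b)) x"
    unfolding 0 ev_D_zero using assms
    by (intro sweedler_counit_right[symmetric] multilin_hd) (simp_all add: 0)
  finally show ?thesis .
next
  case (Suc m)
  have p: "\<And>x. pure_tensor scale [x] \<in> tensor_power scale 1" by (rule pure_tensor_in) simp
  have \<phi>: "multilin (Suc (Suc m)) \<phi>" using assms by (simp add: Suc)
  have "ev \<phi> (D (Suc n) x) = ev (\<lambda>xs. ev \<phi> (tensor_juxt scale 1 (Suc m) (pure_tensor scale [xs ! 0])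
        (D (Suc m) (xs ! 1)))) (comult x)"
    unfolding Suc iter_comult.simps
    by (intro ev_lift[OF \<phi> comult_in] tensor_juxt_in[OF p D_in]) simp
  also have "\<dots> = sweedler (\<lambda>a b. ev (\<lambda>ys. \<phi> (a # ys)) (D n b)) x"
    unfolding sweedler_def
  proof (rule ev_cong[OF comult_in])
    fix xs :: "'h list"
    have "ev \<phi> (tensor_juxt scale 1 (Suc m) (pure_tensor scale [xs ! 0]) (D (Suc m) (xs ! 1)))
      = ev (\<lambda>ys. ev (\<lambda>zs. \<phi> (ys @ zs)) (D (Suc m) (xs ! 1))) (pure_tensor scale [xs ! 0])"
      using \<phi> by (intro ev_juxt p D_in) simp
    also have "\<dots> = ev (\<lambda>zs. \<phi> ([xs ! 0] @ zs)) (D (Suc m) (xs ! 1))"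
      using \<phi> by (intro ev_pure multilin_evI[OF D_in] multilin_append_left[where n = "Suc m"]) simp_all
    finally show "ev \<phi> (tensor_juxt scale 1 (Suc m) (pure_tensor scale [xs ! 0]) (D (Suc m) (xs ! 1)))
      = ev (\<lambda>ys. \<phi> (xs ! 0 # ys)) (D n (xs ! 1))"
      by (simp add: Suc)
  qed
  finally show ?thesis .
qed

lemma lin_counit: "lin (\<lambda>x. scale (counit x) y)"
  by (simp add: lin_def counit_add counit_scale scale_left_distrib scale_scale)

lemma lin_ev_D: "multilin n \<phi> \<Longrightarrow> lin (\<lambda>x. ev \<phi> (D n x))"
proof (induction n arbitrary: \<phi>)
  case 0
  then show ?case by (simp only: ev_D_zero lin_counit)
next
  case (Suc n)
  then show ?case
    unfolding ev_D_Suc[OF Suc.prems]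
    by (intro lin_sweedler bilinI lin_evI[OF D_in] multilin_hd[OF Suc.prems] Suc.IH multilin_tl)
qed

text \<open>Generalized coassociativity: \<open>D (m + n)\<close> is \<open>comult\<close> followed
  by \<open>D m \<otimes> D n\<close>. For \<open>m = 0\<close> this is the left counit axiom; in
  the step the first factor is peeled off and coassociativity regroups the rest.\<close>

lemma ev_D_add:
  "multilin (m + n) \<phi> \<Longrightarrow>
    ev \<phi> (D (m + n) x) = sweedler (\<lambda>a b. ev (\<lambda>xs. ev (\<lambda>ys. \<phi> (xs @ ys)) (D n b)) (D m a)) x"
proof (induction m arbitrary: \<phi> x)
  case 0
  then show ?case
    by (simp only: ev_D_zero) (simp add: sweedler_counit_left lin_ev_D)
next
  case (Suc m)
  then have \<phi>: "multilin (Suc (m + n)) \<phi>" by simp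
  have tl: "multilin (m + n) (\<lambda>ys. \<phi> (a # ys))" for a by (rule multilin_tl[OF \<phi>])
  have "ev \<phi> (D (Suc m + n) x) = sweedler (\<lambda>a b. ev (\<lambda>ys. \<phi> (a # ys)) (D (m + n) b)) x"
    using ev_D_Suc[OF \<phi>] by simp
  also have "\<dots> = sweedler (\<lambda>a b. sweedler (\<lambda>c d.
      ev (\<lambda>xs. ev (\<lambda>ys. \<phi> (a # xs @ ys)) (D n d)) (D m c)) b) x"
    by (simp add: Suc.IH[OF tl])
  \<comment> \<open>The trilinear function has the peeled factor in its first slot, the argument of
    \<open>D m\<close> in its second and that of \<open>D n\<close> in its third.\<close>
  also have "\<dots> = sweedler (\<lambda>a b. sweedler (\<lambda>c d.
      ev (\<lambda>xs. ev (\<lambda>ys. \<phi> (c # xs @ ys)) (D n b)) (D m d)) a) x"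
    by (intro sweedler_coassoc[symmetric] lin_evI[OF D_in] lin_ev_D multilin_evI[OF D_in]
        multilin_append_left[OF tl] multilin_append_right[OF tl] multilin_hd[OF \<phi>])
      simp_all
  also have "\<dots> = sweedler (\<lambda>a b. ev (\<lambda>xs. ev (\<lambda>ys. \<phi> (xs @ ys)) (D n b)) (D (Suc m) a)) x"
  proof (rule sweedler_cong)
    fix a b
    have "multilin (Suc m) (\<lambda>xs. ev (\<lambda>ys. \<phi> (xs @ ys)) (D n b))"
      using Suc.prems by (intro multilin_evI[OF D_in] multilin_append_left)
    from ev_D_Suc[OF this, of a]
    show "sweedler (\<lambda>c d. ev (\<lambda>xs. ev (\<lambda>ys. \<phi> (c # xs @ ys)) (D n b)) (D m d)) a
      = ev (\<lambda>xs. ev (\<lambda>ys. \<phi> (xs @ ys)) (D n b)) (D (Suc m) a)" by simp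
  qed
  finally show ?case .
qed

section \<open>Multiplicativity of the iterated comultiplication\<close>

lemma multilin_mult_left: "multilin n \<phi> \<Longrightarrow> length xs = n \<Longrightarrow> multilin n (\<lambda>ys. \<phi> (map2 (*) xs ys))"
  by (intro multilin_map2) (simp_all add: lin_def distrib_left scale_mult_right)

lemma multilin_mult_right:
  assumes "multilin n \<phi>" "length ys = n"
  shows "multilin n (\<lambda>xs. \<phi> (map2 (*) xs ys))"
proof (rule multilin_cong)
  show "multilin n (\<lambda>xs. \<phi> (map2 (\<lambda>y x. x * y) ys xs))"
    using assms by (intro multilin_map2) (simp_all add: lin_def distrib_right scale_mult_left)
  show "\<phi> (map2 (*) xs ys) = \<phi> (map2 (\<lambda>y x. x * y) ys xs)" for xs
    by (intro arg_cong[of _ _ \<phi>] nth_equalityI) auto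
qed

text \<open>Multiplicativity is inherited from \<open>comult_mult\<close>, one factor at a time;
  with no factors left it is multiplicativity of the counit.\<close>

lemma ev_D_mult:
  "multilin n \<phi> \<Longrightarrow> ev \<phi> (D n (x * y)) = ev (\<lambda>xs. ev (\<lambda>ys. \<phi> (map2 (*) xs ys)) (D n y)) (D n x)"
proof (induction n arbitrary: \<phi> x y)
  case 0
  show ?case by (simp only: ev_D_zero) (simp add: scale_scale counit_mult)
next
  case (Suc n)
  note tl = multilin_tl[OF Suc.prems]
  have "ev \<phi> (D (Suc n) (x * y)) = sweedler (\<lambda>a b. ev (\<lambda>ys. \<phi> (a # ys)) (D n b)) (x * y)"
    by (rule ev_D_Suc[OF Suc.prems])
  also have "\<dots> = sweedler (\<lambda>a b. sweedler (\<lambda>c d. ev (\<lambda>ys. \<phi> (a * c # ys)) (D n (b * d))) y) x"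
    by (intro sweedler_mult bilinI lin_evI[OF D_in] multilin_hd[OF Suc.prems] lin_ev_D tl)
  also have "\<dots> = sweedler (\<lambda>a b. sweedler (\<lambda>c d.
      ev (\<lambda>xs. ev (\<lambda>ys. \<phi> (a * c # map2 (*) xs ys)) (D n d)) (D n b)) y) x"
    by (simp add: Suc.IH[OF tl])
  \<comment> \<open>The evaluation at \<open>D n b\<close> moves outside the Sweedler sum of
    \<open>y\<close>, leaving that sum in the form absorbed by \<open>D (Suc n) y\<close>.\<close>
  also have "\<dots> = sweedler (\<lambda>a b. ev (\<lambda>xs. sweedler (\<lambda>c d.
      ev (\<lambda>ys. \<phi> (a * c # map2 (*) xs ys)) (D n d)) y) (D n b)) x"
    by (simp add: sweedler_ev)
  also have "\<dots> = sweedler (\<lambda>a b. ev (\<lambda>xs. ev (\<lambda>ys. \<phi> (map2 (*) (a # xs) ys)) (D (Suc n) y)) (D n b)) x"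
  proof (intro sweedler_cong ev_cong[OF D_in])
    fix a b and xs :: "'h list" assume "length xs = n"
    then have "multilin (Suc n) (\<lambda>ys. \<phi> (map2 (*) (a # xs) ys))"
      by (intro multilin_mult_left[OF Suc.prems]) simp
    from ev_D_Suc[OF this, of y]
    show "sweedler (\<lambda>c d. ev (\<lambda>ys. \<phi> (a * c # map2 (*) xs ys)) (D n d)) y
      = ev (\<lambda>ys. \<phi> (map2 (*) (a # xs) ys)) (D (Suc n) y)" by simp
  qed
  also have "\<dots> = ev (\<lambda>xs. ev (\<lambda>ys. \<phi> (map2 (*) xs ys)) (D (Suc n) y)) (D (Suc n) x)"
    by (intro ev_D_Suc[symmetric] multilin_evI[OF D_in] multilin_mult_right[OF Suc.prems])
  finally show ?case .
qed

lemma ev_D_one: "multilin n \<phi> \<Longrightarrow> ev \<phi> (D n 1) = \<phi> (replicate n 1)"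
proof (induction n arbitrary: \<phi>)
  case 0
  show ?case by (simp only: ev_D_zero) (simp add: counit_one scale_one)
next
  case (Suc n)
  have "ev \<phi> (D (Suc n) 1) = sweedler (\<lambda>a b. ev (\<lambda>ys. \<phi> (a # ys)) (D n b)) 1"
    by (rule ev_D_Suc[OF Suc.prems])
  also have "\<dots> = ev (\<lambda>ys. \<phi> (1 # ys)) (D n 1)"
    by (intro sweedler_one bilinI lin_evI[OF D_in] multilin_hd[OF Suc.prems] lin_ev_D
        multilin_tl[OF Suc.prems])
  finally show ?case by (simp add: Suc.IH[OF multilin_tl[OF Suc.prems]])
qed

section \<open>Homogeneous components and gradedness\<close>

lemma graded_components_proj: "graded_components G x (\<lambda>n. proj G n x)"
  using theI'[OF direct_sum[of x]] by (simp add: proj_def)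

lemma proj_eqI: "graded_components G x c \<Longrightarrow> proj G n x = c n"
  using direct_sum[of x] graded_components_proj[of x] by metis

lemma proj_in: "proj G n x \<in> G n"
  using graded_components_proj by (auto simp: graded_components_def)

lemma graded_componentsI:
  assumes "\<And>n. c n \<in> G n" "finite S" "\<And>n. n \<notin> S \<Longrightarrow> c n = 0" "x = (\<Sum>n\<in>S. c n)"
  shows "graded_components G x c"
proof -
  have sub: "{n. c n \<noteq> 0} \<subseteq> S" using assms(3) by blast
  then show ?thesis
    using assms sum.mono_neutral_left[OF assms(2) sub, of c]
    by (auto simp: graded_components_def intro: finite_subset)
qed

lemma proj_decompose: "\<exists>S. finite S \<and> (\<forall>n. n \<notin> S \<longrightarrow> proj G n x = 0) \<and> x = (\<Sum>n\<in>S. proj G n x)"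
  using graded_components_proj[of x]
  by (intro exI[of _ "{n. proj G n x \<noteq> 0}"]) (simp add: graded_components_def)

lemma proj_homogeneous: "x \<in> G m \<Longrightarrow> proj G n x = (if m = n then x else 0)"
  by (intro proj_eqI graded_componentsI[where S = "{m}"]) (auto simp: grade_zero)

text \<open>By uniqueness of the decomposition: adding or scaling the components of the arguments
  yields a decomposition of the sum or multiple.\<close>

lemma lin_proj: "lin (proj G n)"
  unfolding lin_def
proof (intro conjI allI)
  fix x y
  obtain S where S: "finite S" "\<And>n. n \<notin> S \<Longrightarrow> proj G n x = 0" "x = (\<Sum>n\<in>S. proj G n x)"
    using proj_decompose by blast
  obtain T where T: "finite T" "\<And>n. n \<notin> T \<Longrightarrow> proj G n y = 0" "y = (\<Sum>n\<in>T. proj G n y)"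
    using proj_decompose by blast
  \<comment> \<open>\<open>x\<close> and \<open>y\<close> may have different supports; both sums are
    extended by zero terms to the union.\<close>
  have "(\<Sum>n\<in>S \<union> T. proj G n x) = (\<Sum>n\<in>S. proj G n x)" "(\<Sum>n\<in>S \<union> T. proj G n y) = (\<Sum>n\<in>T. proj G n y)"
    using S(1,2) T(1,2) by (intro sum.mono_neutral_right; blast)+
  then have "x + y = (\<Sum>n\<in>S \<union> T. proj G n x + proj G n y)"
    using S(3) T(3) by (simp add: sum.distrib)
  then show "proj G n (x + y) = proj G n x + proj G n y"
    using S T by (intro proj_eqI graded_componentsI[where S = "S \<union> T"]) (auto intro: grade_add proj_in)
next
  fix c x
  obtain S where S: "finite S" "\<And>n. n \<notin> S \<Longrightarrow> proj G n x = 0" "x = (\<Sum>n\<in>S. proj G n x)"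
    using proj_decompose by blast
  have "scale c x = (\<Sum>n\<in>S. scale c (proj G n x))"
    using arg_cong[OF S(3), of "scale c"] by (simp add: scale_sum)
  then show "proj G n (scale c x) = scale c (proj G n x)"
    using S by (intro proj_eqI graded_componentsI[where S = S])
      (auto intro: grade_scale proj_in simp: scale_zero_right)
qed

lemma lin_eqI:
  assumes "lin f" "lin g" "\<And>m x. x \<in> G m \<Longrightarrow> f x = g x"
  shows "f x = g x"
proof -
  obtain S where "x = (\<Sum>n\<in>S. proj G n x)"
    using proj_decompose by blast
  then show ?thesis
    using lin_sum[OF assms(1), of "\<lambda>n. proj G n x" S] lin_sum[OF assms(2), of "\<lambda>n. proj G n x" S]
      assms(3)[OF proj_in] by simp
qed

text \<open>The counit vanishes in positive degrees. The scalar multiplies \<open>y\<close> so that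
  both sides are maps into \<open>H\<close>, to which \<open>lin_eqI\<close> applies.\<close>

lemma scale_counit_proj: "scale (counit (proj G n x)) y = (if n = 0 then scale (counit x) y else 0)"
proof (rule lin_eqI[where f = "\<lambda>x. scale (counit (proj G n x)) y"])
  show "lin (\<lambda>x. scale (counit (proj G n x)) y)"
    by (intro lin_compose[OF lin_counit] lin_proj)
  show "lin (\<lambda>x. if n = 0 then scale (counit x) y else 0)"
    by (cases "n = 0") (simp_all add: lin_counit lin_const_zero)
  show "scale (counit (proj G n x)) y = (if n = 0 then scale (counit x) y else 0)" if "x \<in> G m" for m x
    using that lin_zero[OF lin_counit] grade_counit[OF that]
    by (auto simp: proj_homogeneous scale_zero_left)
qed

text \<open>Gradedness of \<open>comult\<close>. For \<open>x\<close> of degree \<open>m\<close>, a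
  term with factors of degrees \<open>d\<close> and \<open>e\<close> has \<open>d + e = m\<close>.
  On the right it can survive only for \<open>i = d\<close> and only when \<open>m = n\<close>, in
  agreement with the projection of \<open>x\<close> on the left.\<close>

lemma sweedler_proj:
  assumes F: "bilin F"
  shows "sweedler F (proj G n x) = (\<Sum>i\<le>n. sweedler (\<lambda>a b. F (proj G i a) (proj G (n - i) b)) x)"
proof (rule lin_eqI[where f = "\<lambda>x. sweedler F (proj G n x)"])
  let ?F = "\<lambda>i a b. F (proj G i a) (proj G (n - i) b)"
  have F': "bilin (?F i)" for i
    using F by (intro bilinI lin_compose[OF bilinD(1)[OF F] lin_proj] lin_compose[OF bilinD(2)[OF F] lin_proj])
  show "lin (\<lambda>x. sweedler F (proj G n x))"
    by (intro lin_compose[OF lin_sweedler] lin_proj F)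
  show "lin (\<lambda>x. \<Sum>i\<le>n. sweedler (?F i) x)"
    by (intro lin_sumI lin_sweedler F')
  fix m x assume x: "x \<in> G m"
  obtain f where f: "f \<in> formal_tensors 2" "comult x = tclass scale 2 f"
    and deg: "\<And>xs. xs \<in> Poly_Mapping.keys f \<Longrightarrow>
      \<exists>ds. sum_list ds = m \<and> list_all2 (\<lambda>x d. x \<in> G d) xs ds"
    using grade_comult[OF x] by (fastforce simp: tensor_grade_def)
  \<comment> \<open>The representative \<open>f\<close> carries the degrees; the one chosen by
    \<open>trep\<close> need not.\<close>
  have ev: "sweedler F' x = lin_ext scale (\<lambda>xs. F' (xs ! 0) (xs ! 1)) f" if "bilin F'" for F'
    using that unfolding sweedler_def f(2) by (intro ev_tclass multilin_bilin f(1))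
  have key: "(\<Sum>i\<le>n. ?F i (xs ! 0) (xs ! 1)) = (if m = n then F (xs ! 0) (xs ! 1) else 0)"
    if xs_key: "xs \<in> Poly_Mapping.keys f" for xs
  proof -
    obtain ds where ds: "sum_list ds = m" "list_all2 (\<lambda>x d. x \<in> G d) xs ds"
      using deg[OF xs_key] by blast
    have "length xs = 2" using xs_key f(1) by (auto simp: formal_tensors_def)
    then obtain a b where xs: "xs = [a, b]"
      by (metis (no_types, lifting) One_nat_def Suc_1 length_0_conv length_Suc_conv)
    obtain d e where de: "ds = [d, e]" "a \<in> G d" "b \<in> G e" "d + e = m"
      using ds by (auto simp: xs list_all2_Cons1)
    \<comment> \<open>Since \<open>i \<le> n\<close>, the truncated \<open>n - i\<close> is a true
      difference, so \<open>i = d\<close> and \<open>n - i = e\<close> together mean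
      \<open>d + e = n\<close>.\<close>
    have "?F i a b = (if i = d then (if d + e = n then F a b else 0) else 0)" if "i \<le> n" for i
      using that lin_zero[OF bilinD(1)[OF F]] lin_zero[OF bilinD(2)[OF F]]
      by (auto simp: proj_homogeneous[OF de(2)] proj_homogeneous[OF de(3)])
    then show ?thesis using de(4) by (auto simp: xs)
  qed
  have "bilin (\<lambda>a b. \<Sum>i\<le>n. ?F i a b)"
    using F' by (intro bilinI lin_sumI) (simp_all add: bilinD[OF F'])
  from ev[OF this] have "(\<Sum>i\<le>n. sweedler (?F i) x)
      = lin_ext scale (\<lambda>xs. if m = n then F (xs ! 0) (xs ! 1) else 0) f"
    by (simp add: sweedler_sum[symmetric] lin_ext_def key del: One_nat_def)
  also have "\<dots> = sweedler F (proj G n x)"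
    using ev[OF F] lin_zero[OF lin_sweedler[OF F]] proj_homogeneous[OF x]
    by (auto simp: lin_ext_def scale_zero_right)
  finally show "sweedler F (proj G n x) = (\<Sum>i\<le>n. sweedler (?F i) x)" ..
qed

definition weak_comps :: "nat \<Rightarrow> nat \<Rightarrow> nat list set" where
  "weak_comps k n = {g. length g = k \<and> sum_list g = n}"

lemma finite_weak_comps: "finite (weak_comps k n)"
  by (rule finite_subset[OF _ finite_lists_length_eq[of "{..n}" k]])
    (auto simp: weak_comps_def member_le_sum_list)

lemma sum_weak_comps_Suc:
  "(\<Sum>g\<in>weak_comps (Suc k) n. h g) = (\<Sum>i\<le>n. \<Sum>g\<in>weak_comps k (n - i). h (i # g) :: 'h)"
proof -
  have "(\<Sum>i\<le>n. \<Sum>g\<in>weak_comps k (n - i). h (i # g))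
      = (\<Sum>(i, g)\<in>(SIGMA i:{..n}. weak_comps k (n - i)). h (i # g))"
    by (simp add: sum.Sigma finite_weak_comps)
  also have "\<dots> = (\<Sum>g\<in>weak_comps (Suc k) n. h g)"
    by (rule sum.reindex_bij_witness[where i = "\<lambda>g. (hd g, tl g)" and j = "\<lambda>(i, g). i # g"])
      (auto simp: weak_comps_def length_Suc_conv)
  finally show ?thesis ..
qed

lemma multilin_proj: "multilin k \<phi> \<Longrightarrow> length g = k \<Longrightarrow> multilin k (\<lambda>xs. \<phi> (map2 (proj G) g xs))"
  by (intro multilin_map2 lin_proj)

text \<open>Gradedness of the iterated comultiplication: \<open>sweedler_proj\<close> gives degree
  \<open>i\<close> to the first factor and \<open>n - i\<close> to the rest, which is treated by
  induction. For \<open>k = 0\<close> only degree \<open>0\<close> has a composition, matching the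
  counit.\<close>

lemma ev_D_proj:
  "multilin k \<phi> \<Longrightarrow>
    ev \<phi> (D k (proj G n x)) = (\<Sum>g\<in>weak_comps k n. ev (\<lambda>xs. \<phi> (map2 (proj G) g xs)) (D k x))"
proof (induction k arbitrary: \<phi> n x)
  case 0
  have "weak_comps 0 n = (if n = 0 then {[]} else {})" by (auto simp: weak_comps_def)
  then show ?case
    by (simp only: ev_D_zero scale_counit_proj) simp
next
  case (Suc k)
  note tl = multilin_tl[OF Suc.prems]
  have "ev \<phi> (D (Suc k) (proj G n x)) = sweedler (\<lambda>a b. ev (\<lambda>xs. \<phi> (a # xs)) (D k b)) (proj G n x)"
    by (rule ev_D_Suc[OF Suc.prems])
  also have "\<dots> = (\<Sum>i\<le>n. sweedler (\<lambda>a b. ev (\<lambda>xs. \<phi> (proj G i a # xs)) (D k (proj G (n - i) b))) x)"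
    by (intro sweedler_proj bilinI lin_evI[OF D_in] multilin_hd[OF Suc.prems] lin_ev_D tl)
  also have "\<dots> = (\<Sum>i\<le>n. \<Sum>g\<in>weak_comps k (n - i).
      sweedler (\<lambda>a b. ev (\<lambda>xs. \<phi> (map2 (proj G) (i # g) (a # xs))) (D k b)) x)"
    by (simp add: Suc.IH[OF tl] sweedler_sum)
  also have "\<dots> = (\<Sum>i\<le>n. \<Sum>g\<in>weak_comps k (n - i). ev (\<lambda>xs. \<phi> (map2 (proj G) (i # g) xs)) (D (Suc k) x))"
    by (intro sum.cong refl ev_D_Suc[symmetric] multilin_proj[OF Suc.prems]) (simp add: weak_comps_def)
  finally show ?case by (simp add: sum_weak_comps_Suc)
qed

end


section \<open>Evaluating several iterated comultiplications\<close>

text \<open>The head and the tail of a related list are chosen independently. This serves both for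
  lists of weak compositions and for choices of tensor keys.\<close>

lemma sum_list_all2_Cons:
  assumes "\<And>x. finite {y. R y x}"
  shows "finite {ys. list_all2 R ys xs}"
    and "(\<Sum>ys\<in>{ys. list_all2 R ys (x # xs)}. h ys) =
      (\<Sum>y\<in>{y. R y x}. \<Sum>ys\<in>{ys. list_all2 R ys xs}. h (y # ys))"
proof -
  show fin: "finite {ys. list_all2 R ys xs}" for xs
  proof (induction xs)
    case (Cons x xs)
    have "{ys. list_all2 R ys (x # xs)} = (\<lambda>(y, ys). y # ys) ` ({y. R y x} \<times> {ys. list_all2 R ys xs})"
      by (auto simp: list_all2_Cons2 image_iff)
    then show ?case using Cons assms by simp
  qed simp
  have "(\<Sum>y\<in>{y. R y x}. \<Sum>ys\<in>{ys. list_all2 R ys xs}. h (y # ys))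
      = (\<Sum>(y, ys)\<in>{y. R y x} \<times> {ys. list_all2 R ys xs}. h (y # ys))"
    by (simp add: sum.cartesian_product)
  also have "\<dots> = (\<Sum>ys\<in>{ys. list_all2 R ys (x # xs)}. h ys)"
    by (rule sum.reindex_bij_witness[where i = "\<lambda>ys. (hd ys, tl ys)" and j = "\<lambda>(y, ys). y # ys"])
      (auto simp: list_all2_Cons2)
  finally show "(\<Sum>ys\<in>{ys. list_all2 R ys (x # xs)}. h ys) =
      (\<Sum>y\<in>{y. R y x}. \<Sum>ys\<in>{ys. list_all2 R ys xs}. h (y # ys))" ..
qed

lemma permute_list_inverse:
  assumes "\<pi> permutes {..<length xs}"
  shows "permute_list \<pi> (permute_list (inv \<pi>) xs) = xs"
    and "permute_list (inv \<pi>) (permute_list \<pi> xs) = xs"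
  using permute_list_compose[OF assms, of "inv \<pi>"] permute_list_compose[OF permutes_inv[OF assms], of \<pi>]
    permutes_inv_o[OF assms] by simp_all

context graded_bialgebra
begin

text \<open>
  \<open>nest k [x\<^sub>1, \<dots>, x\<^sub>n] \<Phi>\<close> evaluates \<open>\<Phi>\<close> at \<open>\<Delta>\<^sup>k x\<^sub>1 \<otimes> \<dots> \<otimes> \<Delta>\<^sup>k x\<^sub>n\<close>, the
  \<open>j\<close>-th argument list holding the \<open>k\<close> factors of \<open>x\<^sub>j\<close>.
\<close>

fun nest :: "nat \<Rightarrow> 'h list \<Rightarrow> ('h list list \<Rightarrow> 'h) \<Rightarrow> 'h" where
  "nest k [] \<Phi> = \<Phi> []"
| "nest k (x # xs) \<Phi> = ev (\<lambda>ys. nest k xs (\<lambda>yss. \<Phi> (ys # yss))) (D k x)"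

text \<open>The arguments are the slots of an \<open>n\<close>-fold tensor product of
  \<open>k\<close>-th tensor powers, with the blocks kept apart.\<close>

definition multilin2 :: "nat \<Rightarrow> nat \<Rightarrow> ('h list list \<Rightarrow> 'h) \<Rightarrow> bool" where
  "multilin2 k n \<Phi> \<longleftrightarrow> (\<forall>yss j. length yss = n \<longrightarrow> (\<forall>ys\<in>set yss. length ys = k) \<longrightarrow> j < n \<longrightarrow>
     multilin k (\<lambda>ys. \<Phi> (yss[j := ys])))"

lemma multilin2_hd:
  assumes "multilin2 k (Suc n) \<Phi>" "length yss = n" "\<forall>ys\<in>set yss. length ys = k"
  shows "multilin k (\<lambda>ys. \<Phi> (ys # yss))"
proof -
  \<comment> \<open>A dummy list of length \<open>k\<close> fills position \<open>0\<close>, only to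
    be overwritten.\<close>
  have "\<forall>ys\<in>set (replicate k undefined # yss). length ys = k" using assms(3) by simp
  moreover have "length (replicate k undefined # yss) = Suc n" using assms(2) by simp
  ultimately have "multilin k (\<lambda>ys. \<Phi> ((replicate k undefined # yss)[0 := ys]))"
    using assms(1) unfolding multilin2_def by blast
  then show ?thesis by simp
qed

lemma multilin2_tl:
  assumes "multilin2 k (Suc n) \<Phi>" "length ys = k"
  shows "multilin2 k n (\<lambda>yss. \<Phi> (ys # yss))"
  unfolding multilin2_def
proof (intro allI impI)
  fix yss :: "'h list list" and j assume "length yss = n" "\<forall>ys\<in>set yss. length ys = k" "j < n"
  then show "multilin k (\<lambda>zs. \<Phi> (ys # yss[j := zs]))"
    using assms(1)[unfolded multilin2_def, rule_format, of "ys # yss" "Suc j"] assms(2) by auto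
qed

lemma multilin2_Suc:
  assumes "\<And>yss. length yss = n \<Longrightarrow> \<forall>ys\<in>set yss. length ys = k \<Longrightarrow> multilin k (\<lambda>ys. \<Phi> (ys # yss))"
    and "\<And>ys. length ys = k \<Longrightarrow> multilin2 k n (\<lambda>yss. \<Phi> (ys # yss))"
  shows "multilin2 k (Suc n) \<Phi>"
  unfolding multilin2_def
proof (intro allI impI)
  fix zss :: "'h list list" and j
  assume z: "length zss = Suc n" "\<forall>ys\<in>set zss. length ys = k" "j < Suc n"
  then obtain zs yss where zss: "zss = zs # yss" by (auto simp: length_Suc_conv)
  show "multilin k (\<lambda>ys. \<Phi> (zss[j := ys]))"
  proof (cases j)
    case 0
    then show ?thesis using assms(1)[of yss] z by (simp add: zss)
  next
    case (Suc i)
    then show ?thesis using assms(2)[of zs, unfolded multilin2_def] z by (simp add: zss)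
  qed
qed

lemma nest_cong:
  "(\<And>yss. length yss = length xs \<Longrightarrow> \<forall>ys\<in>set yss. length ys = k \<Longrightarrow> \<Phi> yss = \<Psi> yss) \<Longrightarrow>
    nest k xs \<Phi> = nest k xs \<Psi>"
proof (induction xs arbitrary: \<Phi> \<Psi>)
  case (Cons x xs)
  show ?case
    unfolding nest.simps by (intro ev_cong[OF D_in] Cons.IH Cons.prems) auto
qed simp

lemma lin_nestI:
  "(\<And>yss. length yss = length xs \<Longrightarrow> \<forall>ys\<in>set yss. length ys = k \<Longrightarrow> lin (\<lambda>x. \<Phi> x yss)) \<Longrightarrow>
    lin (\<lambda>x. nest k xs (\<Phi> x))"
proof (induction xs arbitrary: \<Phi>)
  case (Cons x xs)
  show ?case
    unfolding nest.simps by (intro lin_evI[OF D_in] Cons.IH Cons.prems) auto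
qed simp

lemma multilin_nestI:
  "(\<And>yss. length yss = length xs \<Longrightarrow> \<forall>ys\<in>set yss. length ys = k \<Longrightarrow> multilin m (\<lambda>zs. \<Phi> zs yss)) \<Longrightarrow>
    multilin m (\<lambda>zs. nest k xs (\<Phi> zs))"
  by (auto simp: multilin_def intro!: lin_nestI)

lemma nest_zero: "nest k xs (\<lambda>yss. 0) = 0"
  by (induction xs) (simp_all add: ev_zero)

text \<open>Slot \<open>0\<close> enters through \<open>D k\<close>, whose evaluation is linear;
  every later slot sits inside the tail and is covered by induction.\<close>

lemma multilin_nest: "multilin2 k n \<Phi> \<Longrightarrow> multilin n (\<lambda>xs. nest k xs \<Phi>)"
proof (induction n arbitrary: \<Phi>)
  case 0
  then show ?case by (simp add: multilin_def)
next
  case (Suc n)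
  show ?case
  proof (rule multilinI)
    fix zs :: "'h list" and i assume zs: "length zs = Suc n" "i < Suc n"
    then obtain x xs where x: "zs = x # xs" "length xs = n" by (auto simp: length_Suc_conv)
    show "lin (\<lambda>a. nest k (zs[i := a]) \<Phi>)"
    proof (cases i)
      case 0
      have "lin (\<lambda>a. ev (\<lambda>ys. nest k xs (\<lambda>yss. \<Phi> (ys # yss))) (D k a))"
        using x(2) by (intro lin_ev_D multilin_nestI multilin2_hd[OF Suc.prems]) auto
      then show ?thesis by (simp add: 0 x)
    next
      case (Suc j)
      have "lin (\<lambda>a. ev (\<lambda>ys. nest k (xs[j := a]) (\<lambda>yss. \<Phi> (ys # yss))) (D k x))"
        using x(2) zs(2) Suc
        by (intro lin_evI[OF D_in] multilinD[OF Suc.IH] multilin2_tl[OF Suc.prems]) auto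
      then show ?thesis by (simp add: Suc x)
    qed
  qed
qed

section \<open>Composing iterated comultiplications\<close>

lemma multilin2_concat: "multilin (n * k) \<phi> \<Longrightarrow> multilin2 k n (\<lambda>yss. \<phi> (concat yss))"
proof (induction n arbitrary: \<phi>)
  case 0
  then show ?case by (simp add: multilin2_def)
next
  case (Suc n)
  have \<phi>: "multilin (k + n * k) \<phi>" using Suc.prems by simp
  show ?case
  proof (rule multilin2_Suc)
    fix yss :: "'h list list" assume y: "length yss = n" "\<forall>ys\<in>set yss. length ys = k"
    have "map length yss = replicate n k"
      using y by (intro nth_equalityI) auto
    then have "length (concat yss) = n * k"
      by (simp add: length_concat sum_list_replicate)
    from multilin_append_left[OF \<phi> this]
    show "multilin k (\<lambda>ys. \<phi> (concat (ys # yss)))" by simp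
  next
    fix ys :: "'h list" assume "length ys = k"
    from Suc.IH[OF multilin_append_right[OF \<phi> this]]
    show "multilin2 k n (\<lambda>yss. \<phi> (concat (ys # yss)))" by simp
  qed
qed

text \<open>Applying \<open>D k\<close> to each of the \<open>n\<close> factors of
  \<open>D n x\<close> gives \<open>D (n * k) x\<close>: \<open>ev_D_add\<close> splits off one
  block of \<open>k\<close> factors, and the rest is induction.\<close>

lemma ev_D_times:
  "multilin (n * k) \<phi> \<Longrightarrow> ev \<phi> (D (n * k) x) = ev (\<lambda>xs. nest k xs (\<lambda>yss. \<phi> (concat yss))) (D n x)"
proof (induction n arbitrary: \<phi> x)
  case 0
  show ?case by (simp only: ev_D_zero mult_0) simp
next
  case (Suc n)
  have \<phi>: "multilin (k + n * k) \<phi>" using Suc.prems by simp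
  have "ev \<phi> (D (Suc n * k) x)
      = sweedler (\<lambda>a b. ev (\<lambda>ys. ev (\<lambda>zs. \<phi> (ys @ zs)) (D (n * k) b)) (D k a)) x"
    using ev_D_add[OF \<phi>] by simp
  also have "\<dots> = sweedler (\<lambda>a b. ev (\<lambda>ys. ev (\<lambda>xs. nest k xs (\<lambda>yss. \<phi> (ys @ concat yss))) (D n b)) (D k a)) x"
    by (intro sweedler_cong ev_cong[OF D_in] Suc.IH multilin_append_right[OF \<phi>])
  \<comment> \<open>After the swap, the block of \<open>a\<close> and the blocks of
    \<open>xs\<close> form a single \<open>nest\<close> over \<open>a # xs\<close>.\<close>
  also have "\<dots> = sweedler (\<lambda>a b. ev (\<lambda>xs. nest k (a # xs) (\<lambda>yss. \<phi> (concat yss))) (D n b)) x"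
    by (subst ev_swap) simp
  also have "\<dots> = ev (\<lambda>xs. nest k xs (\<lambda>yss. \<phi> (concat yss))) (D (Suc n) x)"
    by (intro ev_D_Suc[symmetric] multilin_nest multilin2_concat Suc.prems)
  finally show ?case .
qed

text \<open>The product, in the algebra on the \<open>k\<close>-th tensor power, of the pure tensors
  given by the lists in \<open>yss\<close>; the replicated \<open>1\<close> is its unit.\<close>

definition colprod :: "nat \<Rightarrow> 'h list list \<Rightarrow> 'h list" where
  "colprod k yss = foldr (map2 (*)) yss (replicate k 1)"

lemma colprod_simps [simp]:
  "colprod k [] = replicate k 1" "colprod k (ys # yss) = map2 (*) ys (colprod k yss)"
  by (simp_all add: colprod_def)

lemma length_colprod: "\<forall>ys\<in>set yss. length ys = k \<Longrightarrow> length (colprod k yss) = k"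
  by (induction yss) auto

lemma nth_colprod:
  "\<forall>ys\<in>set yss. length ys = k \<Longrightarrow> i < k \<Longrightarrow> colprod k yss ! i = prod_list (map (\<lambda>ys. ys ! i) yss)"
  by (induction yss) (auto simp: length_colprod)

lemma multilin2_colprod: "multilin k \<phi> \<Longrightarrow> multilin2 k n (\<lambda>yss. \<phi> (colprod k yss))"
proof (induction n arbitrary: \<phi>)
  case 0
  then show ?case by (simp add: multilin2_def)
next
  case (Suc n)
  show ?case
  proof (rule multilin2_Suc)
    fix yss :: "'h list list" assume "\<forall>ys\<in>set yss. length ys = k"
    from multilin_mult_right[OF Suc.prems length_colprod[OF this]]
    show "multilin k (\<lambda>ys. \<phi> (colprod k (ys # yss)))" by simp
  next
    fix ys :: "'h list" assume "length ys = k"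
    from Suc.IH[OF multilin_mult_left[OF Suc.prems this]]
    show "multilin2 k n (\<lambda>yss. \<phi> (colprod k (ys # yss)))" by simp
  qed
qed

text \<open>\<open>ev_D_one\<close> handles the empty product and \<open>ev_D_mult\<close> each
  further factor.\<close>

lemma ev_D_prod_list: "multilin k \<phi> \<Longrightarrow> ev \<phi> (D k (prod_list xs)) = nest k xs (\<lambda>yss. \<phi> (colprod k yss))"
proof (induction xs arbitrary: \<phi>)
  case Nil
  then show ?case by (simp add: ev_D_one)
next
  case (Cons x xs)
  have "ev \<phi> (D k (prod_list (x # xs))) = ev (\<lambda>ys. ev (\<lambda>zs. \<phi> (map2 (*) ys zs)) (D k (prod_list xs))) (D k x)"
    using ev_D_mult[OF Cons.prems] by simp
  also have "\<dots> = ev (\<lambda>ys. nest k xs (\<lambda>yss. \<phi> (map2 (*) ys (colprod k yss)))) (D k x)"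
    by (intro ev_cong[OF D_in] Cons.IH multilin_mult_left[OF Cons.prems])
  finally show ?case by simp
qed

text \<open>Matrices with \<open>k\<close> rows and column sums \<beta>, stored by columns; the row
  sums are still free.\<close>

definition comp_lists :: "nat \<Rightarrow> nat list \<Rightarrow> nat list list set" where
  "comp_lists k \<beta> = {gs. list_all2 (\<lambda>g b. g \<in> weak_comps k b) gs \<beta>}"

lemma finite_comp_lists: "finite (comp_lists k \<beta>)"
  unfolding comp_lists_def by (intro sum_list_all2_Cons) (simp add: finite_weak_comps)

text \<open>\<open>ev_D_proj\<close> is applied to each argument, and the separate sums over
  compositions of the parts of \<beta> combine into one.\<close>

lemma nest_proj:
  "multilin2 k n \<Phi> \<Longrightarrow> length \<beta> = n \<Longrightarrow> length xs = n \<Longrightarrow>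
    nest k (map2 (proj G) \<beta> xs) \<Phi> =
    (\<Sum>gs\<in>comp_lists k \<beta>. nest k xs (\<lambda>yss. \<Phi> (map2 (map2 (proj G)) gs yss)))"
proof (induction n arbitrary: \<Phi> \<beta> xs)
  case 0
  then show ?case by (simp add: comp_lists_def)
next
  case (Suc n)
  obtain b \<beta>' where \<beta>: "\<beta> = b # \<beta>'" "length \<beta>' = n" using Suc.prems by (auto simp: length_Suc_conv)
  obtain x xs' where x: "xs = x # xs'" "length xs' = n" using Suc.prems by (auto simp: length_Suc_conv)
  let ?S = "comp_lists k \<beta>'"
  have "nest k (map2 (proj G) \<beta> xs) \<Phi> =
      ev (\<lambda>ys. nest k (map2 (proj G) \<beta>' xs') (\<lambda>yss. \<Phi> (ys # yss))) (D k (proj G b x))"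
    by (simp add: \<beta> x)
  also have "\<dots> = (\<Sum>g\<in>weak_comps k b. ev (\<lambda>ys. nest k (map2 (proj G) \<beta>' xs')
      (\<lambda>yss. \<Phi> (map2 (proj G) g ys # yss))) (D k x))"
    using \<beta> x by (intro ev_D_proj multilin_nestI multilin2_hd[OF Suc.prems(1)]) auto
  also have "\<dots> = (\<Sum>g\<in>weak_comps k b. ev (\<lambda>ys. \<Sum>gs\<in>?S. nest k xs'
      (\<lambda>yss. \<Phi> (map2 (proj G) g ys # map2 (map2 (proj G)) gs yss))) (D k x))"
    using \<beta> x by (intro sum.cong refl ev_cong[OF D_in] Suc.IH multilin2_tl[OF Suc.prems(1)])
      (auto simp: weak_comps_def)
  also have "\<dots> = (\<Sum>gs\<in>comp_lists k \<beta>. nest k xs (\<lambda>yss. \<Phi> (map2 (map2 (proj G)) gs yss)))"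
    by (simp add: comp_lists_def \<beta> x ev_sum finite_weak_comps
        sum_list_all2_Cons(2)[of "\<lambda>g b. g \<in> weak_comps k b"])
  finally show ?case .
qed

text \<open>Written out on the chosen representatives, \<open>nest\<close> is one finite sum over a
  key for each argument. Unlike the recursive definition, this form is symmetric in the
  arguments.\<close>

lemma nest_expand:
  "nest k xs \<Phi> = (\<Sum>yss\<in>{yss. list_all2 (\<lambda>ys x. ys \<in> Poly_Mapping.keys (trep (D k x))) yss xs}.
     scale (\<Prod>j<length xs. Poly_Mapping.lookup (trep (D k (xs ! j))) (yss ! j)) (\<Phi> yss))"
proof (induction xs arbitrary: \<Phi>)
  case Nil
  then show ?case by (simp add: scale_one)
next
  case (Cons x xs)
  let ?R = "\<lambda>ys x. ys \<in> Poly_Mapping.keys (trep (D k x))"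
  show ?case
    by (simp add: sum_list_all2_Cons(2)[of ?R] Cons.IH tensor_eval_def lin_ext_def scale_sum
        scale_scale prod.lessThan_Suc_shift del: prod.lessThan_Suc)
qed

text \<open>Permuting the arguments reindexes the choices of keys; the product of coefficients is
  unchanged because scalars commute.\<close>

lemma nest_permute:
  assumes \<pi>: "\<pi> permutes {..<length xs}"
  shows "nest k (permute_list \<pi> xs) \<Phi> = nest k xs (\<lambda>yss. \<Phi> (permute_list \<pi> yss))"
  unfolding nest_expand
proof (rule sum.reindex_bij_witness[symmetric, where i = "permute_list (inv \<pi>)" and j = "permute_list \<pi>"])
  let ?R = "\<lambda>ys x. ys \<in> Poly_Mapping.keys (trep (D k x))"
  fix yss assume y: "yss \<in> {yss. list_all2 ?R yss xs}"
  then have len: "length yss = length xs" by (auto dest: list_all2_lengthD)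
  show "permute_list (inv \<pi>) (permute_list \<pi> yss) = yss" using permute_list_inverse[of \<pi> yss] \<pi> len by simp
  show "permute_list \<pi> yss \<in> {yss. list_all2 ?R yss (permute_list \<pi> xs)}"
    using y \<pi> len by (simp add: list_all2_permute_list_iff)
  let ?L = "\<lambda>j. Poly_Mapping.lookup (trep (D k (xs ! j))) (yss ! j)"
  have "(\<Prod>j<length xs. ?L j) = (\<Prod>j<length xs. ?L (\<pi> j))"
    using prod.permute[OF \<pi>, of ?L] by (simp add: comp_def)
  then show "scale (\<Prod>j<length (permute_list \<pi> xs).
        Poly_Mapping.lookup (trep (D k (permute_list \<pi> xs ! j))) (permute_list \<pi> yss ! j))
        (\<Phi> (permute_list \<pi> yss))
      = scale (\<Prod>j<length xs. ?L j) (\<Phi> (permute_list \<pi> yss))"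
    using \<pi> len by (simp add: permute_list_nth)
next
  let ?R = "\<lambda>ys x. ys \<in> Poly_Mapping.keys (trep (D k x))"
  fix yss assume y: "yss \<in> {yss. list_all2 ?R yss (permute_list \<pi> xs)}"
  then have len: "length yss = length xs" by (auto dest: list_all2_lengthD)
  show "permute_list \<pi> (permute_list (inv \<pi>) yss) = yss" using permute_list_inverse[of \<pi> yss] \<pi> len by simp
  have "list_all2 ?R (permute_list (inv \<pi>) yss) (permute_list (inv \<pi>) (permute_list \<pi> xs))"
    using y permutes_inv[OF \<pi>] len by (simp add: list_all2_permute_list_iff)
  then show "permute_list (inv \<pi>) yss \<in> {yss. list_all2 ?R yss xs}"
    using permute_list_inverse(2)[OF \<pi>] by simp
qed

end


section \<open>Reindexing\<close>

text \<open>Permutations of \<open>{1..n}\<close> are transported to the list positions \<open>{..<n}\<close>.\<close>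

definition perm0 :: "(nat \<Rightarrow> nat) \<Rightarrow> nat \<Rightarrow> nat" where
  "perm0 \<sigma> i = \<sigma> (Suc i) - 1"

lemma Suc_perm0: "\<sigma> permutes {1..n} \<Longrightarrow> i < n \<Longrightarrow> Suc (perm0 \<sigma> i) = \<sigma> (Suc i)"
  using permutes_in_image[of \<sigma> "{1..n}" "Suc i"] by (simp add: perm0_def)

lemma perm0_permutes:
  assumes "\<sigma> permutes {1..n}"
  shows "perm0 \<sigma> permutes {..<n}"
proof (rule inj_imp_permutes)
  show "inj_on (perm0 \<sigma>) {..<n}"
  proof (rule inj_onI)
    fix i j assume "i \<in> {..<n}" "j \<in> {..<n}" "perm0 \<sigma> i = perm0 \<sigma> j"
    then have "\<sigma> (Suc i) = \<sigma> (Suc j)"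
      using Suc_perm0[OF assms, of i] Suc_perm0[OF assms, of j] by simp
    then show "i = j" using inj_eq[OF permutes_inj[OF assms]] by simp
  qed
  show "perm0 \<sigma> i \<in> {..<n}" if "i \<in> {..<n}" for i
    using that Suc_perm0[OF assms, of i] permutes_in_image[OF assms, of "Suc i"] by auto
  show "perm0 \<sigma> i = i" if "i \<notin> {..<n}" for i
    using that permutes_not_in[OF assms, of "Suc i"] by (simp add: perm0_def)
qed simp

lemma map_nth_permute_list:
  assumes "length xs = n"
  shows "map (\<lambda>i. xs ! (\<sigma> i - 1)) [1..<n + 1] = permute_list (perm0 \<sigma>) xs"
  by (rule nth_equalityI) (simp_all add: permute_list_def perm0_def assms del: upt_Suc)

text \<open>The lexicographic order of pairs \<open>(i, j)\<close> with \<open>j < l\<close> is the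
  order of the numbers \<open>l * i + j\<close>, from which division by \<open>l\<close> recovers
  the pair.\<close>

lemma concat_map_upt:
  "concat (map (\<lambda>i. map (f i) [0..<l]) [0..<k]) = map (\<lambda>m. f (m div l) (m mod l)) [0..<k * l]"
proof (induction k)
  case (Suc k)
  have "[0..<Suc k * l] = [0..<k * l] @ map (\<lambda>j. j + k * l) [0..<l]"
    using upt_add_eq_append[of 0 "k * l" l] by (simp add: map_add_upt add.commute)
  moreover have "map (f k) [0..<l] = map ((\<lambda>m. f (m div l) (m mod l)) \<circ> (\<lambda>j. j + k * l)) [0..<l]"
    by (rule map_cong) auto
  ultimately show ?case using Suc by simp
qed simp

lemma nth_concat_uniform:
  assumes "\<forall>ys\<in>set yss. length ys = k" "a < k" "b < length yss"
  shows "concat yss ! (k * b + a) = yss ! b ! a"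
proof -
  have "yss = map (\<lambda>b. map (\<lambda>a. yss ! b ! a) [0..<k]) [0..<length yss]"
    using assms(1) by (intro nth_equalityI) auto
  then have "concat yss = map (\<lambda>m. yss ! (m div k) ! (m mod k)) [0..<length yss * k]"
    using concat_map_upt[of "\<lambda>b a. yss ! b ! a" k "length yss"] by simp
  moreover have "k * b + a < length yss * k"
    using assms(2,3) mult_le_mono1[of "Suc b" "length yss" k] by (simp add: algebra_simps)
  ultimately show ?thesis using assms(2) by simp
qed

lemma row_reading_eq:
  "row_reading k l \<gamma> = map (\<lambda>m. \<gamma> (Suc (m div l), Suc (m mod l))) [0..<k * l]"
proof -
  have "[1..<n + 1] = map Suc [0..<n]" for n by (simp add: map_Suc_upt)
  then show ?thesis
    unfolding row_reading_def
    using concat_map_upt[of "\<lambda>i j. \<gamma> (Suc i, Suc j)" l k] by (simp add: comp_def)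
qed

text \<open>At zero-based positions the offsets in \<tau>[\<sigma>] disappear: the value is the
  position of entry \<open>perm0 \<sigma> i\<close> in block \<open>perm0 \<tau> j\<close>, for
  blocks of length \<open>k\<close> and \<open>m = l * i + j\<close>.\<close>

lemma perm0_perm_subst:
  assumes "\<sigma> permutes {1..k}" "m < k * l"
  shows "perm0 (perm_subst k \<sigma> l \<tau>) m = k * perm0 \<tau> (m mod l) + perm0 \<sigma> (m div l)"
proof -
  have "m div l < k" using assms(2) by (rule less_mult_imp_div_less)
  from Suc_perm0[OF assms(1) this] assms(2) show ?thesis
    by (simp add: perm0_def[of "perm_subst k \<sigma> l \<tau>"] perm_subst_def) (simp add: perm0_def)
qed

lemma contingency_tables_iff:
  "\<gamma> \<in> contingency_tables \<alpha> \<beta> \<longleftrightarrow>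
    \<gamma> \<in> extensional ({1..length \<alpha>} \<times> {1..length \<beta>}) \<and>
    (\<forall>i<length \<alpha>. (\<Sum>j<length \<beta>. \<gamma> (Suc i, Suc j)) = \<alpha> ! i) \<and>
    (\<forall>j<length \<beta>. (\<Sum>i<length \<alpha>. \<gamma> (Suc i, Suc j)) = \<beta> ! j)"
proof -
  have shift: "(\<forall>i\<in>{1..n}. P i) \<longleftrightarrow> (\<forall>i<n. P (Suc i))" for n P
    by (metis (no_types, lifting) One_nat_def Suc_le_eq Suc_pred atLeastAtMost_iff less_Suc_eq_0_disj
        not_less_eq zero_less_Suc)
  show ?thesis
    unfolding contingency_tables_def
    by (simp add: PiE_def shift[simplified] sum.atLeast1_atMost_eq)
qed

context graded_bialgebra
begin

lemma comp_lists_iff: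
  "gs \<in> comp_lists k \<beta> \<longleftrightarrow> length gs = length \<beta> \<and>
    (\<forall>j<length \<beta>. length (gs ! j) = k \<and> (\<Sum>i<k. gs ! j ! i) = \<beta> ! j)"
  by (auto simp: comp_lists_def weak_comps_def list_all2_conv_all_nth sum_list_sum_nth atLeast0LessThan)

section \<open>The operators as evaluations of multilinear functions\<close>

lemma multilin_prod_list: "multilin n prod_list"
proof (rule multilinI)
  fix xs :: "'h list" and i assume "length xs = n" "i < n"
  then have "prod_list (xs[i := a]) = prod_list (take i xs) * a * prod_list (drop (Suc i) xs)" for a
    by (simp add: upd_conv_take_nth_drop mult.assoc)
  then show "lin (\<lambda>a. prod_list (xs[i := a]))"
    by (simp add: lin_def distrib_left distrib_right scale_mult_left scale_mult_right)
qed

lemma multilin_proj_prod: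
  assumes "\<pi> permutes {..<length \<alpha>}"
  shows "multilin (length \<alpha>) (\<lambda>xs. prod_list (map2 (proj G) \<alpha> (permute_list \<pi> xs)))"
  by (intro multilin_permute[where \<phi> = "\<lambda>xs. prod_list (map2 (proj G) \<alpha> xs)"] assms
      multilin_proj multilin_prod_list refl)

text \<open>The operator acts by \<open>inv \<sigma>\<close> and the action inverts once more, so
  the inverses cancel and position \<open>i\<close> receives factor \<open>perm0 \<sigma> i\<close>.
  The other constituents are lifts, removed by \<open>ev_lift\<close>.\<close>

lemma p_op_eq:
  assumes \<sigma>: "\<sigma> permutes {1..length \<alpha>}"
  shows "p_op scale comult counit G \<alpha> \<sigma> x =
    ev (\<lambda>xs. prod_list (map2 (proj G) \<alpha> (permute_list (perm0 \<sigma>) xs))) (D (length \<alpha>) x)"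
proof -
  let ?n = "length \<alpha>"
  let ?\<phi> = "\<lambda>xs. prod_list (map2 (proj G) \<alpha> xs)"
  have \<phi>: "multilin ?n ?\<phi>"
    by (intro multilin_proj multilin_prod_list refl)
  have pt: "pure_tensor scale (map (\<lambda>i. xs ! (inv (inv \<sigma>) i - 1)) [1..<?n + 1]) \<in> tensor_power scale ?n"
    for xs :: "'h list"
    by (rule pure_tensor_in) (simp del: upt_Suc)
  have act: "perm_action scale ?n (inv \<sigma>) (D ?n x) \<in> tensor_power scale ?n"
    unfolding perm_action_def by (rule tensor_lift_in[OF D_in pt])
  have "p_op scale comult counit G \<alpha> \<sigma> x =
      ev prod_list (proj_tensor scale G \<alpha> (perm_action scale ?n (inv \<sigma>) (D ?n x)))"
    by (simp add: p_op_def iter_mult_def)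
  also have "\<dots> = ev (\<lambda>xs. ev prod_list (pure_tensor scale (map2 (proj G) \<alpha> xs)))
      (perm_action scale ?n (inv \<sigma>) (D ?n x))"
    unfolding proj_tensor_def
    by (rule ev_lift[OF multilin_prod_list act], rule pure_tensor_in) simp
  also have "\<dots> = ev ?\<phi> (perm_action scale ?n (inv \<sigma>) (D ?n x))"
    by (simp add: ev_pure multilin_prod_list)
  also have "\<dots> = ev (\<lambda>xs. ev ?\<phi> (pure_tensor scale (map (\<lambda>i. xs ! (\<sigma> i - 1)) [1..<?n + 1]))) (D ?n x)"
    using ev_lift[OF \<phi> D_in pt] unfolding perm_action_def inv_inv_eq[OF permutes_bij[OF \<sigma>]] .
  also have "\<dots> = ev (\<lambda>xs. ?\<phi> (permute_list (perm0 \<sigma>) xs)) (D ?n x)"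
  proof (rule ev_cong[OF D_in])
    fix xs :: "'h list" assume "length xs = ?n"
    then show "ev ?\<phi> (pure_tensor scale (map (\<lambda>i. xs ! (\<sigma> i - 1)) [1..<?n + 1]))
        = ?\<phi> (permute_list (perm0 \<sigma>) xs)"
      using map_nth_permute_list[of xs ?n \<sigma>] \<phi> by (simp only: ev_pure length_permute_list)
  qed
  finally show ?thesis .
qed

section \<open>Row sums and row reading\<close>

lemma prod_list_proj_in:
  "prod_list (map (\<lambda>j. proj G (d j) (y j)) js) \<in> G (sum_list (map d js))"
  by (induction js) (auto intro: grade_one grade_mult proj_in)

lemma prod_list_zero: "0 \<in> set xs \<Longrightarrow> prod_list xs = (0 :: 'h)"
  by (induction xs) auto

lemma prod_list_concat: "prod_list (concat xss) = prod_list (map prod_list xss :: 'h list)"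
  by (induction xss) simp_all

text \<open>The row-sum condition arises here. Each permuted entry of the column product is a
  product of homogeneous elements, of degree the row sum, so projecting to degree
  \<open>\<alpha> ! i\<close> keeps it or kills it; one killed factor makes the whole product
  \<open>0\<close>.\<close>

lemma proj_prod_colprod:
  assumes \<sigma>: "\<sigma> permutes {1..length \<alpha>}" and \<tau>: "\<tau> permutes {1..l}"
    and gs: "length gs = l" "\<And>j. j < l \<Longrightarrow> length (gs ! j) = length \<alpha>"
    and yss: "length yss = l" "\<forall>ys\<in>set yss. length ys = length \<alpha>"
  shows "prod_list (map2 (proj G) \<alpha> (permute_list (perm0 \<sigma>)
      (colprod (length \<alpha>) (map2 (map2 (proj G)) gs (permute_list (perm0 \<tau>) yss))))) =
    (if \<forall>i<length \<alpha>. (\<Sum>j<l. gs ! j ! perm0 \<sigma> i) = \<alpha> ! i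
     then prod_list (concat (map (\<lambda>i. map (\<lambda>j.
       proj G (gs ! j ! perm0 \<sigma> i) (yss ! perm0 \<tau> j ! perm0 \<sigma> i)) [0..<l]) [0..<length \<alpha>]))
     else 0)"
proof -
  let ?k = "length \<alpha>" and ?A = "perm0 \<sigma>" and ?B = "perm0 \<tau>"
  let ?F = "\<lambda>i j. proj G (gs ! j ! ?A i) (yss ! ?B j ! ?A i)"
  let ?zss = "map2 (map2 (proj G)) gs (permute_list ?B yss)"
  note A = perm0_permutes[OF \<sigma>] and B = perm0_permutes[OF \<tau>]
  have lt: "?A i < ?k" if "i < ?k" for i using that permutes_in_image[OF A, of i] by simp
  have lt': "?B j < l" if "j < l" for j using that permutes_in_image[OF B, of j] by simp
  have nth: "?zss ! j = map2 (proj G) (gs ! j) (yss ! ?B j)" if "j < l" for j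
    using that B by (simp add: gs yss permute_list_nth)
  have len: "\<forall>zs\<in>set ?zss. length zs = ?k"
  proof
    fix zs assume "zs \<in> set ?zss"
    then obtain j where "j < l" "zs = ?zss ! j" by (auto simp: in_set_conv_nth gs yss)
    then show "length zs = ?k" using nth[of j] gs(2)[of j] yss lt'[of j] by simp
  qed
  have col: "colprod ?k ?zss ! ?A i = prod_list (map (?F i) [0..<l])" if i: "i < ?k" for i
  proof -
    have "map (\<lambda>ys. ys ! ?A i) ?zss = map (?F i) [0..<l]"
    proof (rule nth_equalityI)
      fix j assume "j < length (map (\<lambda>ys. ys ! ?A i) ?zss)"
      then have j: "j < l" by (simp add: gs yss)
      then show "map (\<lambda>ys. ys ! ?A i) ?zss ! j = map (?F i) [0..<l] ! j"
        using nth[OF j] lt[OF i] lt'[OF j] gs yss by simp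
    qed (simp add: gs yss)
    then show ?thesis using nth_colprod[OF len lt[OF i]] by simp
  qed
  have main: "map2 (proj G) \<alpha> (permute_list ?A (colprod ?k ?zss))
      = map (\<lambda>i. proj G (\<alpha> ! i) (prod_list (map (?F i) [0..<l]))) [0..<?k]"
    using A by (intro nth_equalityI) (simp_all add: length_colprod[OF len] permute_list_nth col)
  have pr: "proj G (\<alpha> ! i) (prod_list (map (?F i) [0..<l])) =
      (if (\<Sum>j<l. gs ! j ! ?A i) = \<alpha> ! i then prod_list (map (?F i) [0..<l]) else 0)" for i
    using proj_homogeneous[OF prod_list_proj_in[of "\<lambda>j. gs ! j ! ?A i" "\<lambda>j. yss ! ?B j ! ?A i" "[0..<l]"]]
    by (simp add: interv_sum_list_conv_sum_set_nat atLeast0LessThan)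
  show ?thesis
  proof (cases "\<forall>i<?k. (\<Sum>j<l. gs ! j ! ?A i) = \<alpha> ! i")
    case True
    then have "map (\<lambda>i. proj G (\<alpha> ! i) (prod_list (map (?F i) [0..<l]))) [0..<?k]
        = map (\<lambda>i. prod_list (map (?F i) [0..<l])) [0..<?k]"
      by (intro map_cong) (simp_all add: pr)
    with True main show ?thesis by (simp add: prod_list_concat comp_def)
  next
    case False
    then obtain i where i: "i < ?k" "(\<Sum>j<l. gs ! j ! ?A i) \<noteq> \<alpha> ! i" by blast
    then have "0 \<in> set (map (\<lambda>i. proj G (\<alpha> ! i) (prod_list (map (?F i) [0..<l]))) [0..<?k])"
      by (auto simp: pr intro!: image_eqI[of _ _ i])
    with False main show ?thesis by (simp only: prod_list_zero if_False)
  qed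
qed

text \<open>The reason for \<tau>[\<sigma>]: it sends the position of the pair \<open>(i, j)\<close>
  in the row reading to the position in \<open>concat yss\<close> of entry
  \<open>perm0 \<sigma> i\<close> of block \<open>perm0 \<tau> j\<close>.\<close>

lemma map2_row_reading:
  assumes \<sigma>: "\<sigma> permutes {1..k}" and \<tau>: "\<tau> permutes {1..l}"
    and yss: "length yss = l" "\<forall>ys\<in>set yss. length ys = k"
  shows "map2 (proj G) (row_reading k l \<gamma>) (permute_list (perm0 (perm_subst k \<sigma> l \<tau>)) (concat yss)) =
    concat (map (\<lambda>i. map (\<lambda>j.
      proj G (\<gamma> (Suc i, Suc j)) (yss ! perm0 \<tau> j ! perm0 \<sigma> i)) [0..<l]) [0..<k])"
proof -
  let ?\<pi> = "perm0 (perm_subst k \<sigma> l \<tau>)"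
  have "map length yss = replicate l k"
    using yss by (intro nth_equalityI) auto
  then have len: "length (concat yss) = k * l"
    by (simp add: length_concat sum_list_replicate mult.commute)
  have \<pi>: "?\<pi> permutes {..<length (concat yss)}"
    unfolding len by (intro perm0_permutes perm_subst_permutes \<sigma> \<tau>)
  show ?thesis
    unfolding concat_map_upt row_reading_eq
  proof (rule nth_equalityI)
    fix m assume "m < length (map2 (proj G) (map (\<lambda>m. \<gamma> (Suc (m div l), Suc (m mod l))) [0..<k * l])
      (permute_list ?\<pi> (concat yss)))"
    then have m: "m < k * l" by (simp add: len)
    then have "m div l < k" by (rule less_mult_imp_div_less)
    moreover have "m mod l < l" using m by (cases "l = 0") simp_all
    ultimately have "perm0 \<sigma> (m div l) < k" "perm0 \<tau> (m mod l) < l"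
      using permutes_in_image[OF perm0_permutes[OF \<sigma>], of "m div l"]
        permutes_in_image[OF perm0_permutes[OF \<tau>], of "m mod l"] by auto
    then have "concat yss ! ?\<pi> m = yss ! perm0 \<tau> (m mod l) ! perm0 \<sigma> (m div l)"
      using yss by (simp add: perm0_perm_subst[OF \<sigma> m] nth_concat_uniform)
    then show "map2 (proj G) (map (\<lambda>m. \<gamma> (Suc (m div l), Suc (m mod l))) [0..<k * l])
      (permute_list ?\<pi> (concat yss)) ! m =
      map (\<lambda>m. proj G (\<gamma> (Suc (m div l), Suc (m mod l)))
        (yss ! perm0 \<tau> (m mod l) ! perm0 \<sigma> (m div l))) [0..<k * l] ! m"
      using m \<pi> by (simp add: len permute_list_nth)
  qed (simp add: len)
qed

text \<open>Column \<open>j\<close> of the table is \<open>gs ! j\<close> with rows reordered by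
  \<pi>, which preserves the column sums. The hypothesis on \<open>h\<close> confines it to cells in
  range, where list entries and table values agree.\<close>

lemma sum_contingency_tables:
  fixes h :: "(nat \<Rightarrow> nat \<Rightarrow> nat) \<Rightarrow> 'h"
  assumes A: "\<pi> permutes {..<length \<alpha>}"
    and h: "\<And>f g. (\<And>i j. i < length \<alpha> \<Longrightarrow> j < length \<beta> \<Longrightarrow> f i j = g i j) \<Longrightarrow> h f = h g"
  shows "(\<Sum>gs | gs \<in> comp_lists (length \<alpha>) \<beta> \<and>
        (\<forall>i<length \<alpha>. (\<Sum>j<length \<beta>. gs ! j ! \<pi> i) = \<alpha> ! i). h (\<lambda>i j. gs ! j ! \<pi> i)) =
    (\<Sum>\<gamma>\<in>contingency_tables \<alpha> \<beta>. h (\<lambda>i j. \<gamma> (Suc i, Suc j)))"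
proof -
  let ?k = "length \<alpha>" and ?l = "length \<beta>"
  \<comment> \<open>Row \<open>i\<close> of the table is entry \<open>\<pi> i\<close> of the lists,
    so the way back uses \<open>inv \<pi>\<close>; \<open>Suc\<close> shifts to table indices
    starting at \<open>1\<close>.\<close>
  define to_gs where "to_gs = (\<lambda>\<gamma> :: nat \<times> nat \<Rightarrow> nat.
    map (\<lambda>j. map (\<lambda>i. \<gamma> (Suc (inv \<pi> i), Suc j)) [0..<?k]) [0..<?l])"
  \<comment> \<open>\<open>restrict\<close> makes the table \<open>undefined\<close> off the index
    range, as \<open>contingency_tables\<close> demands.\<close>
  define to_table where "to_table = (\<lambda>gs :: nat list list.
    restrict (\<lambda>(i, j). gs ! (j - 1) ! \<pi> (i - 1)) ({1..?k} \<times> {1..?l}))"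
  have lt: "\<pi> i < ?k" if "i < ?k" for i using that permutes_in_image[OF A, of i] by simp
  have lt': "inv \<pi> i < ?k" if "i < ?k" for i
    using that permutes_in_image[OF permutes_inv[OF A], of i] by simp
  have table: "to_table gs (Suc i, Suc j) = gs ! j ! \<pi> i" if "i < ?k" "j < ?l" for gs i j
    using that by (simp add: to_table_def)
  have perm: "(\<Sum>i<?k. f (\<pi> i)) = (\<Sum>i<?k. f i)" for f :: "nat \<Rightarrow> nat"
    using sum.permute[OF A, of f] by (simp add: comp_def)
  have perm': "(\<Sum>i<?k. f (inv \<pi> i)) = (\<Sum>i<?k. f i)" for f :: "nat \<Rightarrow> nat"
    using sum.permute[OF permutes_inv[OF A], of f] by (simp add: comp_def)
  show ?thesis
  proof (rule sum.reindex_bij_witness[where i = to_gs and j = to_table])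
    fix gs assume "gs \<in> {gs. gs \<in> comp_lists ?k \<beta> \<and> (\<forall>i<?k. (\<Sum>j<?l. gs ! j ! \<pi> i) = \<alpha> ! i)}"
    then have gs: "length gs = ?l" "\<And>j. j < ?l \<Longrightarrow> length (gs ! j) = ?k"
      "\<And>j. j < ?l \<Longrightarrow> (\<Sum>i<?k. gs ! j ! i) = \<beta> ! j"
      "\<And>i. i < ?k \<Longrightarrow> (\<Sum>j<?l. gs ! j ! \<pi> i) = \<alpha> ! i"
      by (auto simp: comp_lists_iff)
    show "to_gs (to_table gs) = gs"
    proof (rule nth_equalityI)
      fix j assume "j < length (to_gs (to_table gs))"
      then have j: "j < ?l" by (simp add: to_gs_def)
      show "to_gs (to_table gs) ! j = gs ! j"
        using j by (intro nth_equalityI)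
          (simp_all add: to_gs_def table lt' gs permutes_inverses[OF A])
    qed (simp add: to_gs_def gs)
    show "to_table gs \<in> contingency_tables \<alpha> \<beta>"
      unfolding contingency_tables_iff
    proof (intro conjI allI impI)
      show "to_table gs \<in> extensional ({1..?k} \<times> {1..?l})" by (simp add: to_table_def)
      show "(\<Sum>j<?l. to_table gs (Suc i, Suc j)) = \<alpha> ! i" if "i < ?k" for i
        using that gs(4) by (simp add: table)
      show "(\<Sum>i<?k. to_table gs (Suc i, Suc j)) = \<beta> ! j" if "j < ?l" for j
        using that gs(3)[OF that] perm[of "\<lambda>i. gs ! j ! i"] by (simp add: table)
    qed
    show "h (\<lambda>i j. to_table gs (Suc i, Suc j)) = h (\<lambda>i j. gs ! j ! \<pi> i)"
      by (rule h) (rule table)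
  next
    fix \<gamma> assume \<gamma>: "\<gamma> \<in> contingency_tables \<alpha> \<beta>"
    have gs: "to_gs \<gamma> ! j ! i = \<gamma> (Suc (inv \<pi> i), Suc j)" if "i < ?k" "j < ?l" for i j
      using that by (simp add: to_gs_def)
    show "to_table (to_gs \<gamma>) = \<gamma>"
    proof (rule extensionalityI)
      show "to_table (to_gs \<gamma>) \<in> extensional ({1..?k} \<times> {1..?l})" by (simp add: to_table_def)
      show "\<gamma> \<in> extensional ({1..?k} \<times> {1..?l})" using \<gamma> by (simp add: contingency_tables_iff)
      fix p assume "p \<in> {1..?k} \<times> {1..?l}"
      then obtain i j where "p = (Suc i, Suc j)" "i < ?k" "j < ?l"
        by (cases p; cases "fst p"; cases "snd p") auto
      then show "to_table (to_gs \<gamma>) p = \<gamma> p"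
        by (simp add: table gs lt permutes_inverses[OF A])
    qed
    have "(\<Sum>i<?k. to_gs \<gamma> ! j ! i) = \<beta> ! j" if "j < ?l" for j
      using that \<gamma> perm'[of "\<lambda>i. \<gamma> (Suc i, Suc j)"] by (simp add: gs contingency_tables_iff)
    moreover have "(\<Sum>j<?l. to_gs \<gamma> ! j ! \<pi> i) = \<alpha> ! i" if "i < ?k" for i
      using that \<gamma> by (simp add: gs lt contingency_tables_iff permutes_inverses[OF A])
    moreover have "length (to_gs \<gamma>) = ?l" "\<And>j. j < ?l \<Longrightarrow> length (to_gs \<gamma> ! j) = ?k"
      by (simp_all add: to_gs_def)
    ultimately show "to_gs \<gamma> \<in>
        {gs. gs \<in> comp_lists ?k \<beta> \<and> (\<forall>i<?k. (\<Sum>j<?l. gs ! j ! \<pi> i) = \<alpha> ! i)}"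
      by (simp add: comp_lists_iff)
  qed
qed

lemma nest_if: "nest k xs (\<lambda>yss. if P then \<Phi> yss else 0) = (if P then nest k xs \<Phi> else 0)"
  by (cases P) (simp_all add: nest_zero)

lemma p_op_comp:
  assumes \<sigma>: "\<sigma> permutes {1..length \<alpha>}" and \<tau>: "\<tau> permutes {1..length \<beta>}"
  shows "p_op scale comult counit G \<alpha> \<sigma> (p_op scale comult counit G \<beta> \<tau> x) =
    (\<Sum>\<gamma>\<in>contingency_tables \<alpha> \<beta>. p_op scale comult counit G
       (row_reading (length \<alpha>) (length \<beta>) \<gamma>) (perm_subst (length \<alpha>) \<sigma> (length \<beta>) \<tau>) x)"
proof -
  let ?k = "length \<alpha>" and ?l = "length \<beta>" and ?A = "perm0 \<sigma>" and ?B = "perm0 \<tau>"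
  let ?\<phi> = "\<lambda>zs. prod_list (map2 (proj G) \<alpha> (permute_list ?A zs))"
  let ?\<Psi> = "\<lambda>c yss. prod_list (concat (map (\<lambda>i. map (\<lambda>j.
       proj G (c i j) (yss ! ?B j ! ?A i)) [0..<?l]) [0..<?k]))"
  let ?ok = "\<lambda>gs. \<forall>i<?k. (\<Sum>j<?l. gs ! j ! ?A i) = \<alpha> ! i"
  let ?\<rho> = "perm_subst ?k \<sigma> ?l \<tau>"
  note A = perm0_permutes[OF \<sigma>] and B = perm0_permutes[OF \<tau>]
  have \<phi>: "multilin ?k ?\<phi>" by (rule multilin_proj_prod[OF A])
  \<comment> \<open>The left operator is evaluated on one term \<open>xs\<close> of the right one:
    multiplicativity, gradedness, reordering by \<tau>, then selection of the row sums.\<close>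
  have inner: "ev ?\<phi> (D ?k (prod_list (map2 (proj G) \<beta> (permute_list ?B xs)))) =
      (\<Sum>gs | gs \<in> comp_lists ?k \<beta> \<and> ?ok gs. nest ?k xs (?\<Psi> (\<lambda>i j. gs ! j ! ?A i)))"
    if xs: "length xs = ?l" for xs
  proof -
    have "ev ?\<phi> (D ?k (prod_list (map2 (proj G) \<beta> (permute_list ?B xs))))
        = nest ?k (map2 (proj G) \<beta> (permute_list ?B xs)) (\<lambda>yss. ?\<phi> (colprod ?k yss))"
      by (rule ev_D_prod_list[OF \<phi>])
    also have "\<dots> = (\<Sum>gs\<in>comp_lists ?k \<beta>. nest ?k (permute_list ?B xs)
        (\<lambda>yss. ?\<phi> (colprod ?k (map2 (map2 (proj G)) gs yss))))"
      using xs by (intro nest_proj[OF multilin2_colprod[OF \<phi>]]) simp_all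
    \<comment> \<open>The permutation by \<tau> moves from the arguments to their lists of factors,
      so that \<open>nest\<close> runs over \<open>xs\<close> in its original order, as in
      \<open>ev_D_times\<close>.\<close>
    also have "\<dots> = (\<Sum>gs\<in>comp_lists ?k \<beta>. nest ?k xs
        (\<lambda>yss. ?\<phi> (colprod ?k (map2 (map2 (proj G)) gs (permute_list ?B yss)))))"
      using B xs by (simp only: nest_permute)
    also have "\<dots> = (\<Sum>gs\<in>comp_lists ?k \<beta>. if ?ok gs then nest ?k xs (?\<Psi> (\<lambda>i j. gs ! j ! ?A i)) else 0)"
    proof (rule sum.cong[OF refl])
      fix gs assume "gs \<in> comp_lists ?k \<beta>"
      then have gs: "length gs = ?l" "\<And>j. j < ?l \<Longrightarrow> length (gs ! j) = ?k"
        by (auto simp: comp_lists_iff)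
      have "nest ?k xs (\<lambda>yss. ?\<phi> (colprod ?k (map2 (map2 (proj G)) gs (permute_list ?B yss))))
          = nest ?k xs (\<lambda>yss. if ?ok gs then ?\<Psi> (\<lambda>i j. gs ! j ! ?A i) yss else 0)"
        using xs by (intro nest_cong proj_prod_colprod[OF \<sigma> \<tau> gs]) simp_all
      also have "\<dots> = (if ?ok gs then nest ?k xs (?\<Psi> (\<lambda>i j. gs ! j ! ?A i)) else 0)"
        by (rule nest_if)
      finally show "nest ?k xs (\<lambda>yss. ?\<phi> (colprod ?k (map2 (map2 (proj G)) gs (permute_list ?B yss))))
          = (if ?ok gs then nest ?k xs (?\<Psi> (\<lambda>i j. gs ! j ! ?A i)) else 0)" .
    qed
    also have "\<dots> = (\<Sum>gs | gs \<in> comp_lists ?k \<beta> \<and> ?ok gs. nest ?k xs (?\<Psi> (\<lambda>i j. gs ! j ! ?A i)))"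
      by (simp add: sum.inter_filter[symmetric] finite_comp_lists)
    finally show ?thesis .
  qed
  \<comment> \<open>For a fixed table, the blocks are concatenated and the comultiplications merge
    into one with \<open>?l * ?k\<close> factors, giving a single operator.\<close>
  have row: "ev (\<lambda>xs. nest ?k xs (?\<Psi> (\<lambda>i j. \<gamma> (Suc i, Suc j)))) (D ?l x) =
      p_op scale comult counit G (row_reading ?k ?l \<gamma>) ?\<rho> x" for \<gamma>
  proof -
    let ?\<psi> = "\<lambda>zs. prod_list (map2 (proj G) (row_reading ?k ?l \<gamma>) (permute_list (perm0 ?\<rho>) zs))"
    have len: "length (row_reading ?k ?l \<gamma>) = ?l * ?k" by (simp add: row_reading_eq)
    have \<rho>: "?\<rho> permutes {1..length (row_reading ?k ?l \<gamma>)}"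
      using perm_subst_permutes[OF \<sigma> \<tau>] by (simp only: len mult.commute)
    have "ev (\<lambda>xs. nest ?k xs (?\<Psi> (\<lambda>i j. \<gamma> (Suc i, Suc j)))) (D ?l x)
        = ev (\<lambda>xs. nest ?k xs (\<lambda>yss. ?\<psi> (concat yss))) (D ?l x)"
      by (intro ev_cong[OF D_in] nest_cong) (simp add: map2_row_reading[OF \<sigma> \<tau>])
    also have "\<dots> = ev ?\<psi> (D (?l * ?k) x)"
      using multilin_proj_prod[OF perm0_permutes[OF \<rho>]] by (intro ev_D_times[symmetric]) (simp only: len)
    finally show ?thesis by (simp only: p_op_eq[OF \<rho>] len)
  qed
  \<comment> \<open>The left operator is linear, hence can be moved inside the evaluation at
    \<open>D ?l x\<close>.\<close>
  have "p_op scale comult counit G \<alpha> \<sigma> (p_op scale comult counit G \<beta> \<tau> x)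
      = ev (\<lambda>xs. ev ?\<phi> (D ?k (prod_list (map2 (proj G) \<beta> (permute_list ?B xs))))) (D ?l x)"
    unfolding p_op_eq[OF \<sigma>] p_op_eq[OF \<tau>] by (rule lin_ev[OF lin_ev_D[OF \<phi>]])
  also have "\<dots> = ev (\<lambda>xs. \<Sum>gs | gs \<in> comp_lists ?k \<beta> \<and> ?ok gs.
      nest ?k xs (?\<Psi> (\<lambda>i j. gs ! j ! ?A i))) (D ?l x)"
    by (rule ev_cong[OF D_in inner])
  also have "\<dots> = (\<Sum>gs | gs \<in> comp_lists ?k \<beta> \<and> ?ok gs.
      ev (\<lambda>xs. nest ?k xs (?\<Psi> (\<lambda>i j. gs ! j ! ?A i))) (D ?l x))"
    by (rule ev_sum)
  also have "\<dots> = (\<Sum>\<gamma>\<in>contingency_tables \<alpha> \<beta>.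
      ev (\<lambda>xs. nest ?k xs (?\<Psi> (\<lambda>i j. \<gamma> (Suc i, Suc j)))) (D ?l x))"
  proof (rule sum_contingency_tables[OF A, where h = "\<lambda>c. ev (\<lambda>xs. nest ?k xs (?\<Psi> c)) (D ?l x)"])
    fix f g :: "nat \<Rightarrow> nat \<Rightarrow> nat" assume "\<And>i j. i < ?k \<Longrightarrow> j < ?l \<Longrightarrow> f i j = g i j"
    then have "?\<Psi> f = ?\<Psi> g"
      by (intro ext arg_cong[of _ _ prod_list] arg_cong[of _ _ concat] map_cong) auto
    then show "ev (\<lambda>xs. nest ?k xs (?\<Psi> f)) (D ?l x) = ev (\<lambda>xs. nest ?k xs (?\<Psi> g)) (D ?l x)"
      by (simp only:)
  qed
  finally show ?thesis by (simp only: row)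
qed

end

theorem theorem1p19:
  fixes scale :: "'k::{comm_ring,comm_monoid_mult} \<Rightarrow> 'h::{ring,monoid_mult} \<Rightarrow> 'h"
    and comult :: "'h \<Rightarrow> ('k, 'h) tensor"
    and counit :: "'h \<Rightarrow> 'k"
    and G :: "nat \<Rightarrow> 'h set"
    and k l :: nat
    and \<alpha> \<beta> :: "nat list"
    and \<sigma> \<tau> :: "nat \<Rightarrow> nat"
  assumes "graded_bialgebra scale comult counit G"
    and "length \<alpha> = k" and "\<sigma> permutes {1..k}"
    and "length \<beta> = l" and "\<tau> permutes {1..l}"
  shows "p_op scale comult counit G \<alpha> \<sigma> \<circ> p_op scale comult counit G \<beta> \<tau> =
    (\<lambda>x. \<Sum>\<gamma>\<in>contingency_tables \<alpha> \<beta>.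
       p_op scale comult counit G (row_reading k l \<gamma>) (perm_subst k \<sigma> l \<tau>) x)"
proof
  fix x
  show "(p_op scale comult counit G \<alpha> \<sigma> \<circ> p_op scale comult counit G \<beta> \<tau>) x =
    (\<Sum>\<gamma>\<in>contingency_tables \<alpha> \<beta>.
       p_op scale comult counit G (row_reading k l \<gamma>) (perm_subst k \<sigma> l \<tau>) x)"
    using graded_bialgebra.p_op_comp[OF assms(1), of \<sigma> \<alpha> \<tau> \<beta> x] assms(2-5) by simp
qed

end
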